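(* Let $K$ be a field, $S=K[t_1,\ldots,t_s]$, and let $\mathcal{L}\subset\mathbb{Z}^s$ be a lattice of rank $r$. Then the following hold. (a) If $r=s$, then $\deg(S/I(\mathcal{L}))=|\mathbb{Z}^s/\mathcal{L}|$. (b) If $r<s$, there is an integer matrix $A$ of size $(s-r)\times s$ with ${\rm rank}(A)=s-r$ such that we have the containment of rank $r$ lattices $\mathcal{L}\subset{\rm ker}_{\mathbb{Z}}(A)$, with equality if and only if $\mathbb{Z}^s/\mathcal{L}$ is torsion-free. (c) If $r<s$ and $v_1,\ldots,v_s$ are the columns of a matrix $A$ as in (b), then $$\deg(S/I(\mathcal{L}))=\frac{|T(\mathbb{Z}^s/\mathcal{L})|\,(s-r)!\,{\rm vol}({\rm conv}(0,v_1,\ldots,v_s))}{|T(\mathbb{Z}^{s-r}/\langle v_1,\ldots,v_s\rangle)|}.$$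
   Context: A lattice is a subgroup $\mathcal{L}$ of $\mathbb{Z}^s$. For $a\in\mathbb{Z}^s$ write $a=a^+-a^-$ with $a^+,a^-\in\mathbb{N}^s$ of disjoint support, and $t^c=t_1^{c_1}\cdots t_s^{c_s}$. The lattice ideal of $\mathcal{L}$ over $K$ is $I(\mathcal{L})=(t^{a^+}-t^{a^-}\mid a\in\mathcal{L})\subset S$. ${\rm ker}_{\mathbb{Z}}(A)=\{\alpha\in\mathbb{Z}^s\mid A\alpha^\top=0\}$. $T(M)$ is the torsion subgroup of an abelian group $M$, and $\langle v_1,\ldots,v_s\rangle$ is the subgroup of $\mathbb{Z}^{s-r}$ generated by the $v_i$. ${\rm conv}$ denotes convex hull and ${\rm vol}$ denotes the relative volume of a lattice polytope (volume in its affine span, normalized so that a fundamental domain of the lattice of integer points of the affine span has volume $1$; here the polytope is full-dimensional in $\mathbb{R}^{s-r}$). For an ideal $I\subset S$ with $k=\dim(S/I)$ (Krull dimension), the degree is $\deg(S/I)=k!\lim_{i\to\infty}\dim_K(S_{\le i}/I_{\le i})/i^k$, where $S_{\le i}$ (resp. $I_{\le i}$) is the space of polynomials of $S$ (resp. of $I$) of standard total degree at most $i$. *)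

theory Defs
  imports
    "HOL-Analysis.Analysis"
    "HOL-Library.Poly_Mapping"
    "HOL-Algebra.Algebra"
    "HOL-Algebra.Algebraic_Closure_Type"
begin

text \<open>The polynomial ring over \<open>'k\<close> in variables indexed by the finite type \<open>'s\<close>: finitely
  supported coefficient functions on exponent vectors.\<close>

type_synonym ('s, 'k) mpoly = "('s \<Rightarrow>\<^sub>0 nat) \<Rightarrow>\<^sub>0 'k"

text \<open>Supremum of the lengths of chains of prime ideals (by convention 0 for the zero ring).\<close>

definition krull_dim :: "('a, 'm) ring_scheme \<Rightarrow> enat" where
  "krull_dim R = (SUP n \<in> {n. \<exists>P. (\<forall>i\<le>n. primeideal (P i) R) \<and> (\<forall>i<n. P i \<subset> P (Suc i))}. enat n)"

definition total_deg :: "('s::finite \<Rightarrow>\<^sub>0 nat) \<Rightarrow> nat" where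
  "total_deg m = (\<Sum>j\<in>UNIV. Poly_Mapping.lookup m j)"

definition deg_le :: "nat \<Rightarrow> ('s::finite, 'k::zero) mpoly set" where
  "deg_le i = {p. \<forall>m\<in>Poly_Mapping.keys p. total_deg m \<le> i}"

text \<open>Multiplication by a constant polynomial.\<close>

definition scal :: "'k::field \<Rightarrow> ('s::finite, 'k) mpoly \<Rightarrow> ('s, 'k) mpoly" where
  "scal c p = Poly_Mapping.single 0 c * p"

text \<open>For subspaces \<open>W \<subseteq> V\<close>: the residue classes of the elements of \<open>B\<close> in \<open>V / W\<close> are
  pairwise distinct and form a basis of \<open>V / W\<close>.\<close>

definition quotient_basis ::
  "('s::finite, 'k::field) mpoly set \<Rightarrow> ('s, 'k) mpoly set \<Rightarrow> ('s, 'k) mpoly set \<Rightarrow> bool" where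
  "quotient_basis V W B \<longleftrightarrow> B \<subseteq> V \<and>
     (\<forall>v\<in>V. \<exists>T u. finite T \<and> T \<subseteq> B \<and> v - (\<Sum>b\<in>T. scal (u b) b) \<in> W) \<and>
     (\<forall>T u. finite T \<and> T \<subseteq> B \<and> (\<Sum>b\<in>T. scal (u b) b) \<in> W \<longrightarrow> (\<forall>b\<in>T. u b = 0))"

definition quotient_dim :: "('s::finite, 'k::field) mpoly set \<Rightarrow> ('s, 'k) mpoly set \<Rightarrow> nat" where
  "quotient_dim V W = card (SOME B. quotient_basis V W B)"

text \<open>The degree of \<open>S / I\<close>, where \<open>S\<close> is the full polynomial ring. Since the library's \<open>lim\<close>
  is a definite description, it is meaningful only when the sequence converges.\<close>

definition quotient_degree :: "('s::finite, 'k::field) mpoly set \<Rightarrow> real" where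
  "quotient_degree I =
     (let k = the_enat (krull_dim (ring_of_type_algebra Quot I))
      in fact k * lim (\<lambda>i. real (quotient_dim (deg_le i) (I \<inter> deg_le i)) / real i ^ k))"

text \<open>Truncation by \<open>nat\<close> makes \<open>pos_part a\<close> the exponent vector $a^+$; then $a^-$ is
  \<open>pos_part (- a)\<close>.\<close>

definition pos_part :: "int ^ 's::finite \<Rightarrow> ('s \<Rightarrow>\<^sub>0 nat)" where
  "pos_part a = Poly_Mapping.Abs_poly_mapping (\<lambda>j. nat (a $ j))"

definition lattice_ideal :: "(int ^ 's::finite) set \<Rightarrow> ('s, 'k::field) mpoly set" where
  "lattice_ideal L = genideal ring_of_type_algebra
     {Poly_Mapping.single (pos_part a) 1 - Poly_Mapping.single (pos_part (- a)) 1 | a. a \<in> L}"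

definition additive_group :: "'a::ab_group_add monoid" where
  "additive_group = \<lparr>carrier = UNIV, monoid.mult = (+), one = 0\<rparr>"

definition torsion :: "('a, 'm) monoid_scheme \<Rightarrow> 'a set" where
  "torsion G = {x \<in> carrier G. \<exists>n::nat. n > 0 \<and> x [^]\<^bsub>G\<^esub> n = \<one>\<^bsub>G\<^esub>}"

definition torsion_free :: "('a, 'm) monoid_scheme \<Rightarrow> bool" where
  "torsion_free G \<longleftrightarrow> torsion G = {\<one>\<^bsub>G\<^esub>}"

text \<open>Rank of a subgroup of $\mathbb{Z}^s$: the maximal number of elements that are linearly
  independent over the integers.\<close>

definition lattice_rank :: "(int ^ 's::finite) set \<Rightarrow> nat" where
  "lattice_rank L =
     Max {card B | B. B \<subseteq> L \<and> finite B \<and> \<not> module.dependent ((*s) :: int \<Rightarrow> int ^ 's \<Rightarrow> int ^ 's) B}"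

definition int_kernel :: "int ^ 's::finite ^ 'd::finite \<Rightarrow> (int ^ 's) set" where
  "int_kernel A = {\<alpha>. A *v \<alpha> = 0}"

definition real_matrix :: "int ^ 's::finite ^ 'd::finite \<Rightarrow> real ^ 's ^ 'd" where
  "real_matrix A = map_matrix real_of_int A"

end

(* S/I(L) has as K-basis the cosets of L that contain a nonnegative vector, filtered by total degree,
   so its Hilbert function N(i) counts the cosets that meet the dilated simplex of degree i.

   Modulo ker(A) these cosets become the points of the lattice <v_1,...,v_s> in i conv(0,v_1,...,v_s),
   each hit |T(Z^s/L)| times away from the boundary, and the lattice has index
   |T(Z^(s-r)/<v_1,...,v_s>)| in Z^(s-r). Comparing lattice points with volume gives the limit of
   N(i)/i^(s-r).

   A chain of primes of length n forces N to grow at least like i^n, which bounds the Krull dimension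
   by s-r; the toric ideals of the lattices cut out by the first few rows of A form a chain of that
   length. *)
theory Submission
  imports Defs
begin

section \<open>Pushforward of polynomials along maps of exponents\<close>

text \<open>Every ideal whose quotient is computed arises as the kernel of one construction, the
  linear map \<open>push f\<close> that moves each monomial along a map \<open>f\<close> of
  exponents. For the lattice ideal, \<open>f\<close> picks an exponent in each coset: it is not
  additive, but its values are again exponents, so the quotient embeds linearly into the polynomial
  ring and dimensions are counted there. For the primes of the explicit chain, \<open>f\<close> is
  additive into a linearly ordered group, and \<open>push f\<close> is a ring homomorphism into a
  domain over every field.

  The Krull dimension is the exponent in the definition of the degree, so it has to be settled
  before the limit has a meaning. One asymptotic estimate serves both purposes: the limit that gives
  the degree also caps the length of prime chains.

  Counting is done up to a bounded shift of i, because (i + c)^d / i^d tends to 1. Each rounding and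
  each choice of representatives is paid for with a constant.

  Ranks and torsion are read off from the real span of a lattice; expanding reals over a family
  independent over the integers turns real relations between integer vectors into integer
  ones.\<close>

definition push :: "('a \<Rightarrow> 'b) \<Rightarrow> ('a \<Rightarrow>\<^sub>0 'k) \<Rightarrow> ('b \<Rightarrow>\<^sub>0 'k::comm_monoid_add)" where
  "push f p = (\<Sum>m\<in>Poly_Mapping.keys p. Poly_Mapping.single (f m) (Poly_Mapping.lookup p m))"

lemma push_superset:
  assumes "finite S" "Poly_Mapping.keys p \<subseteq> S"
  shows "push f p = (\<Sum>m\<in>S. Poly_Mapping.single (f m) (Poly_Mapping.lookup p m))"
  unfolding push_def using assms
  by (intro sum.mono_neutral_left) (auto simp: in_keys_iff)

lemma push_single [simp]: "push f (Poly_Mapping.single m c) = Poly_Mapping.single (f m) c"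
  by (subst push_superset[of "{m}"]) auto

lemma push_zero [simp]: "push f 0 = 0"
  by (simp add: push_def)

lemma push_add: "push f (p + q) = push f p + push f q"
proof -
  let ?S = "Poly_Mapping.keys p \<union> Poly_Mapping.keys q"
  have "Poly_Mapping.keys (p + q) \<subseteq> ?S" by (rule keys_add)
  then show ?thesis
    by (simp add: push_superset[of ?S] lookup_add single_add sum.distrib)
qed

lemma push_uminus: "push f (- p) = - push f (p :: _ \<Rightarrow>\<^sub>0 'k::ab_group_add)"
  using push_add[of f p "- p"] by (simp add: add_eq_0_iff)

lemma push_diff: "push f (p - q) = push f p - push f (q :: _ \<Rightarrow>\<^sub>0 'k::ab_group_add)"
  using push_add[of f p "- q"] by (simp add: push_uminus)

lemma push_sum: "push f (\<Sum>x\<in>S. g x) = (\<Sum>x\<in>S. push f (g x))"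
  by (induction S rule: infinite_finite_induct) (auto simp: push_add)

lemma push_ident: "(\<And>m. m \<in> Poly_Mapping.keys p \<Longrightarrow> f m = m) \<Longrightarrow> push f p = p"
  unfolding push_def
  by (intro poly_mapping_eqI) (simp add: lookup_sum lookup_single when_def in_keys_iff)

lemma poly_eq_sum_single:
  "p = (\<Sum>m\<in>Poly_Mapping.keys p. Poly_Mapping.single m (Poly_Mapping.lookup p m))"
  using push_ident[of p id] by (simp add: push_def)

lemma push_push: "push f (push g p) = push (f \<circ> g) p"
  by (subst (2) push_def) (simp add: push_sum, simp add: push_def)

lemma push_cong: "(\<And>m. m \<in> Poly_Mapping.keys p \<Longrightarrow> f m = g m) \<Longrightarrow> push f p = push g p"
  unfolding push_def by (intro sum.cong) auto

lemma keys_push: "Poly_Mapping.keys (push f p) \<subseteq> f ` Poly_Mapping.keys p"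
proof
  fix x assume "x \<in> Poly_Mapping.keys (push f p)"
  then have "Poly_Mapping.lookup (push f p) x \<noteq> 0" by (simp add: in_keys_iff)
  then obtain m where "m \<in> Poly_Mapping.keys p"
    "Poly_Mapping.lookup (Poly_Mapping.single (f m) (Poly_Mapping.lookup p m)) x \<noteq> 0"
    unfolding push_def lookup_sum by (meson sum.neutral)
  then show "x \<in> f ` Poly_Mapping.keys p" by (auto simp: lookup_single when_def split: if_splits)
qed

lemma poly_mult_expand:
  fixes p q :: "'a::comm_monoid_add \<Rightarrow>\<^sub>0 'k::comm_semiring_0"
  shows "p * q = (\<Sum>m\<in>Poly_Mapping.keys p. \<Sum>n\<in>Poly_Mapping.keys q.
     Poly_Mapping.single (m + n) (Poly_Mapping.lookup p m * Poly_Mapping.lookup q n))"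
  by (subst poly_eq_sum_single[of p], subst poly_eq_sum_single[of q])
     (simp add: sum_product mult_single)

lemma push_mult:
  fixes p q :: "'a::comm_monoid_add \<Rightarrow>\<^sub>0 'k::comm_semiring_0"
  assumes "\<And>a b. f (a + b) = f a + f b"
  shows "push f (p * q) = push f p * (push f q :: 'b::comm_monoid_add \<Rightarrow>\<^sub>0 'k)"
  by (subst poly_mult_expand) (simp add: push_sum assms, simp add: push_def sum_product mult_single)

text \<open>Substitute for multiplicativity when \<open>f\<close> picks a representative in each
  class of a congruence: a sum of representatives need not be one, but it lies in the right
  class.\<close>

lemma push_mult_congruence:
  fixes p q :: "'a::comm_monoid_add \<Rightarrow>\<^sub>0 'k::comm_semiring_0"
  assumes "\<And>a b. f (a + f b) = f (a + b)"
  shows "push f (p * push f q) = push f (p * q)"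
proof -
  have "p * push f q = (\<Sum>m\<in>Poly_Mapping.keys p. \<Sum>n\<in>Poly_Mapping.keys q.
     Poly_Mapping.single (m + f n) (Poly_Mapping.lookup p m * Poly_Mapping.lookup q n))"
    by (subst poly_eq_sum_single[of p], subst push_def) (simp add: sum_product mult_single)
  then have "push f (p * push f q) = (\<Sum>m\<in>Poly_Mapping.keys p. \<Sum>n\<in>Poly_Mapping.keys q.
     Poly_Mapping.single (f (m + n)) (Poly_Mapping.lookup p m * Poly_Mapping.lookup q n))"
    by (simp add: push_sum assms)
  also have "\<dots> = push f (p * q)"
    by (subst poly_mult_expand) (simp add: push_sum)
  finally show ?thesis .
qed

lemma push_scal:
  fixes p :: "('s::finite, 'k::field) mpoly"
  shows "push f (scal c p) = (scal c (push f p) :: ('s, 'k) mpoly)"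
proof -
  have *: "scal c (push f p) =
      (\<Sum>m\<in>Poly_Mapping.keys p. Poly_Mapping.single (f m) (c * Poly_Mapping.lookup p m))"
    for f :: "_ \<Rightarrow> 's \<Rightarrow>\<^sub>0 nat"
    unfolding scal_def push_def by (simp add: sum_distrib_left mult_single)
  \<comment> \<open>The formula \<open>*\<close> at \<open>id\<close> expands
    \<open>scal c p\<close> itself, also when c = 0 makes its keys vanish.\<close>
  have "push f (scal c p) = push f (scal c (push id p))" by (simp add: push_ident)
  also have "\<dots> = (\<Sum>m\<in>Poly_Mapping.keys p. Poly_Mapping.single (f m) (c * Poly_Mapping.lookup p m))"
    by (simp only: *) (simp add: push_sum)
  finally show ?thesis by (simp only: *)
qed

section \<open>Vector space structure, degree filtration and independence modulo a subspace\<close>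

interpretation mpoly: vector_space "scal :: 'k::field \<Rightarrow> ('s::finite, 'k) mpoly \<Rightarrow> ('s, 'k) mpoly"
  by unfold_locales
     (simp_all add: scal_def distrib_left distrib_right single_add mult.assoc[symmetric] mult_single)

lemma keys_scal: "Poly_Mapping.keys (scal c p) \<subseteq> Poly_Mapping.keys p"
  using keys_mult[of "Poly_Mapping.single 0 c" p] by (auto simp: scal_def split: if_splits)

lemma scal_mult: "scal c (p * q) = p * scal c q" "scal c (p * q) = scal c p * q"
  by (simp_all add: scal_def ac_simps)

lemma total_deg_add: "total_deg (a + b) = total_deg a + total_deg b"
  by (simp add: total_deg_def lookup_add sum.distrib)

lemma finite_total_deg: "finite {m :: 's::finite \<Rightarrow>\<^sub>0 nat. total_deg m \<le> i}"
proof (rule finite_imageD)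
  have "Poly_Mapping.lookup m j \<le> total_deg m" for m :: "'s \<Rightarrow>\<^sub>0 nat" and j
    unfolding total_deg_def by (rule member_le_sum) auto
  then have "Poly_Mapping.lookup ` {m :: 's \<Rightarrow>\<^sub>0 nat. total_deg m \<le> i} \<subseteq> (\<Pi>\<^sub>E j\<in>UNIV. {..i})"
    by (auto simp: PiE_UNIV_domain intro: order_trans)
  then show "finite (Poly_Mapping.lookup ` {m :: 's \<Rightarrow>\<^sub>0 nat. total_deg m \<le> i})"
    by (rule finite_subset) (rule finite_PiE, simp_all)
  show "inj_on Poly_Mapping.lookup {m :: 's \<Rightarrow>\<^sub>0 nat. total_deg m \<le> i}"
    by (rule inj_onI) (rule poly_mapping_eqI, simp)
qed

lemma deg_le_mono: "i \<le> j \<Longrightarrow> deg_le i \<subseteq> deg_le j"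
  by (fastforce simp: deg_le_def)

lemma deg_le_mult: "p \<in> deg_le i \<Longrightarrow> q \<in> deg_le j \<Longrightarrow> p * q \<in> deg_le (i + j)"
  unfolding deg_le_def using keys_mult[of p q] by (auto simp: total_deg_add dest!: subsetD intro!: add_mono)

lemma deg_le_exists: "\<exists>i. p \<in> deg_le i"
  by (rule exI[of _ "Max (total_deg ` Poly_Mapping.keys p)"]) (auto simp: deg_le_def)

lemma subspace_deg_le: "mpoly.subspace (deg_le i :: ('s::finite, 'k::field) mpoly set)"
proof (rule mpoly.subspaceI)
  show "p + q \<in> deg_le i" if "p \<in> deg_le i" "q \<in> deg_le i" for p q :: "('s, 'k) mpoly"
    using that keys_add[of p q] by (fastforce simp: deg_le_def)
  show "scal c p \<in> deg_le i" if "p \<in> deg_le i" for c :: 'k and p :: "('s, 'k) mpoly"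
    using that keys_scal[of c p] by (fastforce simp: deg_le_def)
qed (auto simp: deg_le_def)

lemma scal_single: "scal c (Poly_Mapping.single m d) = Poly_Mapping.single m (c * d)"
  by (simp add: scal_def mult_single)

lemma inj_single_one: "inj (\<lambda>m. Poly_Mapping.single m (1::'k::zero_neq_one))"
  by (rule injI) (metis lookup_single_eq lookup_single_not_eq zero_neq_one)

lemma independent_monomials:
  "mpoly.independent ((\<lambda>m. Poly_Mapping.single m 1) ` M :: ('s::finite, 'k::field) mpoly set)"
  unfolding mpoly.independent_explicit_finite_subsets
proof (intro allI impI ballI)
  fix S :: "('s, 'k) mpoly set" and u v
  assume S: "S \<subseteq> (\<lambda>m. Poly_Mapping.single m 1) ` M" "finite S" "(\<Sum>v\<in>S. scal (u v) v) = 0" "v \<in> S"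
  then obtain m where m: "v = Poly_Mapping.single m 1" by auto
  have "0 = Poly_Mapping.lookup (\<Sum>v\<in>S. scal (u v) v) m" using S by simp
  also have "\<dots> = (\<Sum>w\<in>S. if w = v then u v else 0)"
    unfolding lookup_sum
  proof (rule sum.cong)
    fix w assume "w \<in> S"
    then obtain n where n: "w = Poly_Mapping.single n 1" using S by auto
    have "w = v \<longleftrightarrow> n = m" using inj_single_one[where ?'k = 'k] by (auto simp: m n dest: injD)
    then show "Poly_Mapping.lookup (scal (u w) w) m = (if w = v then u v else 0)"
      by (auto simp: n m scal_single lookup_single when_def)
  qed simp
  finally show "u v = 0" using S by simp
qed

text \<open>The independence clause of \<open>quotient_basis\<close> on its own; lower bounds for
  the growth of a quotient are stated with it.\<close>

definition indep_mod :: "('s::finite, 'k::field) mpoly set \<Rightarrow> ('s, 'k) mpoly set \<Rightarrow> bool" where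
  "indep_mod W B \<longleftrightarrow>
     (\<forall>T u. finite T \<and> T \<subseteq> B \<and> (\<Sum>b\<in>T. scal (u b) b) \<in> W \<longrightarrow> (\<forall>b\<in>T. u b = 0))"

definition push_kernel :: "(('s \<Rightarrow>\<^sub>0 nat) \<Rightarrow> 'b) \<Rightarrow> ('s::finite, 'k::field) mpoly set" where
  "push_kernel f = {p. push f p = 0}"

text \<open>A linear map is injective modulo its kernel, so independence modulo the kernel becomes
  ordinary independence of the images.\<close>

lemma indep_mod_push_image:
  fixes f :: "('s::finite \<Rightarrow>\<^sub>0 nat) \<Rightarrow> ('s \<Rightarrow>\<^sub>0 nat)"
  assumes B: "indep_mod (push_kernel f) B"
  shows "inj_on (push f) B" "mpoly.independent (push f ` B)"
proof -
  have rel: "\<forall>b\<in>T. u b = 0"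
    if "finite T" "T \<subseteq> B" "(\<Sum>b\<in>T. scal (u b) (push f b)) = 0" for T u
    using B that unfolding indep_mod_def push_kernel_def
    by (auto simp: push_sum push_scal)
  show inj: "inj_on (push f) B"
  proof (rule inj_onI, rule ccontr)
    fix a b assume ab: "a \<in> B" "b \<in> B" "push f a = push f b" "a \<noteq> b"
    then have "(\<Sum>x\<in>{a, b}. scal (if x = a then 1 else - 1) (push f x)) = 0"
      by (simp add: mpoly.scale_left_imp_eq)
    then show False using rel[of "{a, b}" "\<lambda>x. if x = a then 1 else - 1"] ab by auto
  qed
  show "mpoly.independent (push f ` B)"
    unfolding mpoly.independent_explicit_finite_subsets
  proof (intro allI impI)
    fix S u assume S: "S \<subseteq> push f ` B" "finite S" "(\<Sum>v\<in>S. scal (u v) v) = 0"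
    then obtain T where T: "T \<subseteq> B" "S = push f ` T" "finite T"
      by (meson finite_subset_image)
    have "(\<Sum>b\<in>T. scal (u (push f b)) (push f b)) = 0"
      using S inj T by (simp add: sum.reindex inj_on_subset)
    then show "\<forall>v\<in>S. u v = 0" using rel[of T "\<lambda>b. u (push f b)"] T by auto
  qed
qed

text \<open>The images under \<open>push f\<close> are combinations of the monomials at
  \<open>f m\<close> with \<open>total_deg m \<le> i\<close>, and an independent set is no larger
  than a finite spanning set. The exponents \<open>f m\<close> themselves may have larger
  degree.\<close>

lemma indep_mod_card_le:
  fixes f :: "('s::finite \<Rightarrow>\<^sub>0 nat) \<Rightarrow> ('s \<Rightarrow>\<^sub>0 nat)"
    and B :: "('s, 'k::field) mpoly set"
  assumes B: "indep_mod (push_kernel f) B" and deg: "B \<subseteq> deg_le i"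
  shows "finite B \<and> card B \<le> card (f ` {m. total_deg m \<le> i})"
proof -
  let ?E = "(\<lambda>m. Poly_Mapping.single m 1) ` f ` {m. total_deg m \<le> i} :: ('s, 'k) mpoly set"
  have fin: "finite (f ` {m :: 's \<Rightarrow>\<^sub>0 nat. total_deg m \<le> i})"
    by (intro finite_imageI finite_total_deg)
  have span: "push f ` B \<subseteq> mpoly.span ?E"
  proof clarify
    fix b assume "b \<in> B"
    then have "Poly_Mapping.keys b \<subseteq> {m. total_deg m \<le> i}" using deg by (auto simp: deg_le_def)
    then have "scal (Poly_Mapping.lookup b m) (Poly_Mapping.single (f m) 1) \<in> mpoly.span ?E"
      if "m \<in> Poly_Mapping.keys b" for m
      using that by (intro mpoly.span_scale mpoly.span_base) auto
    then show "push f b \<in> mpoly.span ?E"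
      unfolding push_def by (intro mpoly.span_sum) (simp add: scal_single)
  qed
  have "finite (push f ` B) \<and> card (push f ` B) \<le> card ?E"
    by (rule mpoly.independent_span_bound[OF finite_imageI[OF fin] indep_mod_push_image(2)[OF B] span])
  moreover have "card ?E \<le> card (f ` {m. total_deg m \<le> i})"
    by (rule card_image_le[OF fin])
  ultimately show ?thesis
    using card_image[OF indep_mod_push_image(1)[OF B]] finite_imageD[OF _ indep_mod_push_image(1)[OF B]]
    by simp
qed

lemma indep_mod_subspace:
  assumes "B \<subseteq> V" "mpoly.subspace V"
  shows "indep_mod (W \<inter> V) B \<longleftrightarrow> indep_mod W B"
proof -
  have "(\<Sum>b\<in>T. scal (u b) b) \<in> V" if "T \<subseteq> B" for T u
    using that assms by (intro mpoly.subspace_sum mpoly.subspace_scale) auto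
  then show ?thesis unfolding indep_mod_def by blast
qed

section \<open>Hilbert functions of kernels of pushforwards\<close>

lemma quotient_basis_indep_mod:
  "quotient_basis V W B \<longleftrightarrow> B \<subseteq> V \<and>
     (\<forall>v\<in>V. \<exists>T u. finite T \<and> T \<subseteq> B \<and> v - (\<Sum>b\<in>T. scal (u b) b) \<in> W) \<and> indep_mod W B"
  by (simp only: quotient_basis_def indep_mod_def)

lemma quotient_dim_push_kernel:
  fixes f :: "('s::finite \<Rightarrow>\<^sub>0 nat) \<Rightarrow> ('s \<Rightarrow>\<^sub>0 nat)"
  shows "quotient_dim (deg_le i) (push_kernel f \<inter> deg_le i :: ('s, 'k::field) mpoly set)
           = card (f ` {m. total_deg m \<le> i})"
proof -
  let ?D = "{m :: 's \<Rightarrow>\<^sub>0 nat. total_deg m \<le> i}"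
  let ?V = "deg_le i :: ('s, 'k) mpoly set" and ?J = "push_kernel f :: ('s, 'k) mpoly set"
  let ?X = "\<lambda>m :: 's \<Rightarrow>\<^sub>0 nat. Poly_Mapping.single m (1 :: 'k)"
  have qb: "quotient_basis ?V (?J \<inter> ?V) B \<longleftrightarrow> B \<subseteq> ?V \<and>
     (\<forall>v\<in>?V. \<exists>T u. finite T \<and> T \<subseteq> B \<and> v - (\<Sum>b\<in>T. scal (u b) b) \<in> ?J \<inter> ?V) \<and> indep_mod ?J B" for B
    by (cases "B \<subseteq> ?V")
      (simp_all only: quotient_basis_indep_mod indep_mod_subspace[OF _ subspace_deg_le] simp_thms)
  \<comment> \<open>\<open>quotient_dim\<close> selects a basis by choice, so the size is proved for
    every basis, and existence separately.\<close>
  have "card B = card (f ` ?D)" if B: "quotient_basis ?V (?J \<inter> ?V) B" for B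
  proof (rule antisym)
    have B': "finite B" "card B \<le> card (f ` ?D)"
      using indep_mod_card_le[of f B i] B unfolding qb by blast+
    then show "card B \<le> card (f ` ?D)" by simp
    have "?X ` f ` ?D \<subseteq> mpoly.span (push f ` B)"
    proof clarify
      fix m :: "'s \<Rightarrow>\<^sub>0 nat" assume "total_deg m \<le> i"
      then have "?X m \<in> ?V" by (auto simp: deg_le_def)
      then obtain T u where T: "finite T" "T \<subseteq> B" "?X m - (\<Sum>b\<in>T. scal (u b) b) \<in> ?J"
        using B unfolding qb by blast
      then have "?X (f m) = (\<Sum>b\<in>T. scal (u b) (push f b))"
        by (simp add: push_kernel_def push_diff push_sum push_scal)
      also have "\<dots> \<in> mpoly.span (push f ` B)"
        using T by (intro mpoly.span_sum mpoly.span_scale mpoly.span_base) auto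
      finally show "?X (f m) \<in> mpoly.span (push f ` B)" .
    qed
    then have le: "card (?X ` f ` ?D) \<le> card (push f ` B)"
      by (rule conjunct2[OF mpoly.independent_span_bound[OF finite_imageI[OF B'(1)] independent_monomials]])
    have "card (f ` ?D) = card (?X ` f ` ?D)"
      by (rule card_image[OF inj_on_subset[OF inj_single_one subset_UNIV], symmetric])
    also note le
    also have "card (push f ` B) \<le> card B" using B'(1) by (rule card_image_le)
    finally show "card (f ` ?D) \<le> card B" .
  qed
  moreover have "\<exists>B. quotient_basis ?V (?J \<inter> ?V) B"
  proof -
    \<comment> \<open>The exponent \<open>f m\<close> can leave the degree bound, so basis monomials
      are taken from the fibres of \<open>f\<close> inside \<open>?D\<close>.\<close>
    define s where "s c = (SOME m. m \<in> ?D \<and> f m = c)" for c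
    have s: "s c \<in> ?D" "f (s c) = c" if "c \<in> f ` ?D" for c
      using someI_ex[of "\<lambda>m. m \<in> ?D \<and> f m = c"] that unfolding s_def[symmetric] by auto
    define B where "B = ?X ` s ` f ` ?D"
    have "B \<subseteq> ?V" using s by (auto simp: B_def deg_le_def)
    moreover have "\<exists>T u. finite T \<and> T \<subseteq> B \<and> v - (\<Sum>b\<in>T. scal (u b) b) \<in> ?J \<inter> ?V" if v: "v \<in> ?V" for v
    proof -
      have keys: "Poly_Mapping.keys v \<subseteq> ?D" using v by (auto simp: deg_le_def)
      \<comment> \<open>Replacing each monomial by the basis monomial in its fibre changes
        \<open>v\<close> only by an element of the kernel and keeps the degree bound.\<close>
      have "push (s \<circ> f) v = (\<Sum>m\<in>Poly_Mapping.keys v. scal (Poly_Mapping.lookup v m) (?X (s (f m))))"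
        by (simp add: push_def scal_single)
      also have "\<dots> \<in> mpoly.span B"
        using keys by (intro mpoly.span_sum mpoly.span_scale mpoly.span_base) (auto simp: B_def)
      finally obtain T u where T: "finite T" "T \<subseteq> B" "push (s \<circ> f) v = (\<Sum>b\<in>T. scal (u b) b)"
        unfolding mpoly.span_explicit by auto
      have "push f (push (s \<circ> f) v) = push f v"
        unfolding push_push using keys s by (intro push_cong) auto
      then have "v - push (s \<circ> f) v \<in> ?J" by (simp add: push_kernel_def push_diff)
      moreover have "push (s \<circ> f) v \<in> ?V"
        using keys_push[of "s \<circ> f" v] keys s by (force simp: deg_le_def)
      ultimately have "v - (\<Sum>b\<in>T. scal (u b) b) \<in> ?J \<inter> ?V"
        using v mpoly.subspace_diff[OF subspace_deg_le] by (simp add: T(3))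
      then show ?thesis using T(1,2) by blast
    qed
    moreover have "indep_mod ?J B"
      unfolding indep_mod_def
    proof (intro allI impI)
      fix T u assume T: "finite T \<and> T \<subseteq> B \<and> (\<Sum>b\<in>T. scal (u b) b) \<in> ?J"
      define p where "p = (\<Sum>b\<in>T. scal (u b) b)"
      \<comment> \<open>\<open>push (s \<circ> f)\<close> fixes the elements of \<open>B\<close> and
        factors through \<open>push f\<close>, so a combination of \<open>B\<close> in the kernel is
        zero.\<close>
      have "p = (\<Sum>b\<in>T. push (s \<circ> f) (scal (u b) b))"
        unfolding p_def using T s by (intro sum.cong) (auto simp: B_def scal_single)
      also have "\<dots> = push s (push f p)" by (simp add: p_def push_push push_sum)
      also have "\<dots> = 0" using T by (simp add: p_def push_kernel_def)
      finally have "p = 0" .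
      moreover have "mpoly.independent B" unfolding B_def by (rule independent_monomials)
      ultimately show "\<forall>b\<in>T. u b = 0"
        using T unfolding mpoly.independent_explicit_finite_subsets p_def by blast
    qed
    ultimately show ?thesis unfolding qb by blast
  qed
  ultimately show ?thesis
    unfolding quotient_dim_def using someI_ex[of "quotient_basis ?V (?J \<inter> ?V)"] by simp
qed

section \<open>Chains of prime ideals and growth\<close>

lemma (in ring) quot_carrier_rep:
  assumes "U \<in> carrier (R Quot I)"
  shows "\<exists>a\<in>carrier R. U = I +> a"
  using assms by (simp add: FactRing_def A_RCOSETS_def')

lemma (in cring) primeideal_quot:
  assumes I: "ideal I R" and J: "primeideal J R" "I \<subseteq> J"
  shows "primeideal ((+>) I ` J) (R Quot I)" "\<Union> ((+>) I ` J) = J"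
proof -
  interpret J: primeideal J R by fact
  show union: "\<Union> ((+>) I ` J) = J"
    using iffD1[OF ideal_incl_iff[OF I J.is_ideal] J(2)] by (rule sym)
  have ideal: "ideal ((+>) I ` J) (R Quot I)"
    by (rule ring_ideal_imp_quot_ideal[OF I J.is_ideal])
  have mem: "I +> a \<in> (+>) I ` J \<longleftrightarrow> a \<in> J" if "a \<in> carrier R" for a
    using canonical_proj_vimage_mem_iff[OF I additive_subgroup.a_subset[OF ideal.axioms(1)[OF ideal]] that]
    unfolding union by (rule sym)
  show "primeideal ((+>) I ` J) (R Quot I)"
  proof (rule primeidealI[OF ideal ideal.quotient_is_cring[OF I is_cring]])
    have "\<one> \<notin> J" using J.I_notcarr J.one_imp_carrier by metis
    then have "I +> \<one> \<notin> (+>) I ` J" using mem[of \<one>] one_closed by metis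
    moreover have "I +> \<one> \<in> carrier (R Quot I)"
      by (rule ring_hom_closed[OF ideal.rcos_ring_hom[OF I] one_closed])
    ultimately show "carrier (R Quot I) \<noteq> (+>) I ` J" by blast
  next
    fix U V assume UV: "U \<in> carrier (R Quot I)" "V \<in> carrier (R Quot I)"
      "U \<otimes>\<^bsub>R Quot I\<^esub> V \<in> (+>) I ` J"
    from quot_carrier_rep[OF UV(1)] quot_carrier_rep[OF UV(2)]
    obtain a b where ab: "a \<in> carrier R" "b \<in> carrier R" "U = I +> a" "V = I +> b"
      by (elim bexE)
    have "U \<otimes>\<^bsub>R Quot I\<^esub> V = I +> (a \<otimes> b)"
      using ideal.rcoset_mult_add[OF I ab(1,2)] by (simp add: ab FactRing_def)
    then have "a \<otimes> b \<in> J" using UV(3) mem[of "a \<otimes> b"] ab(1,2) m_closed by metis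
    then have "a \<in> J \<or> b \<in> J" by (rule J.I_prime[OF ab(1,2)])
    then show "U \<in> (+>) I ` J \<or> V \<in> (+>) I ` J"
      unfolding ab(3,4) by blast
  qed
qed

lemma (in cring) primeideal_Union_quot:
  assumes I: "ideal I R" and J: "primeideal J (R Quot I)"
  shows "primeideal (\<Union> J) R" "I \<subseteq> \<Union> J" "(+>) I ` (\<Union> J) = J"
proof -
  interpret J: primeideal J "R Quot I" by fact
  have sub: "J \<subseteq> carrier (R Quot I)" by (rule J.a_subset)
  have eq: "\<Union> J = {r \<in> carrier R. I +> r \<in> J}"
    using canonical_proj_vimage_in_carrier[OF I sub] canonical_proj_vimage_mem_iff[OF I sub] by blast
  show "primeideal (\<Union> J) R"
    unfolding eq by (rule ring_hom_ring.primeideal_vimage[OF ideal.rcos_ring_hom_ring[OF I] is_cring J])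
  have "I \<in> J" using additive_subgroup.zero_closed[OF ideal.axioms(1)[OF J.is_ideal]] by (simp add: FactRing_def)
  then show "I \<subseteq> \<Union> J" by blast
  show "(+>) I ` (\<Union> J) = J"
  proof (intro equalityI subsetI)
    fix U assume U: "U \<in> J"
    then have "U \<in> carrier (R Quot I)" using sub by (rule subsetD[rotated])
    from quot_carrier_rep[OF this] obtain a where "a \<in> carrier R" "U = I +> a" by (elim bexE)
    then show "U \<in> (+>) I ` (\<Union> J)" unfolding eq using U by blast
  qed (unfold eq, blast)
qed

text \<open>Projection and union of cosets are mutually inverse between primes above
  \<open>I\<close> and primes of the quotient; being injective and monotone, both preserve strict
  inclusions.\<close>

lemma (in cring) krull_dim_quot:
  assumes I: "ideal I R"
  shows "krull_dim (R Quot I) = (SUP n \<in> {n. \<exists>P. (\<forall>i\<le>n. primeideal (P i) R \<and> I \<subseteq> P i) \<and>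
            (\<forall>i<n. P i \<subset> P (Suc i))}. enat n)"
proof -
  have "{n. \<exists>P. (\<forall>i\<le>n. primeideal (P i) (R Quot I)) \<and> (\<forall>i<n. P i \<subset> P (Suc i))} =
     {n. \<exists>P. (\<forall>i\<le>n. primeideal (P i) R \<and> I \<subseteq> P i) \<and> (\<forall>i<n. P i \<subset> P (Suc i))}"
    (is "?A = ?B")
  proof (intro equalityI subsetI)
    fix n assume "n \<in> ?A"
    then obtain P where P: "\<And>i. i \<le> n \<Longrightarrow> primeideal (P i) (R Quot I)" "\<And>i. i < n \<Longrightarrow> P i \<subset> P (Suc i)"
      by blast
    have "(\<Union> (P i)) \<subset> (\<Union> (P (Suc i)))" if "i < n" for i
    proof
      show "\<Union> (P i) \<subseteq> \<Union> (P (Suc i))" using P(2)[OF that] by blast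
      have "(+>) I ` (\<Union> (P i)) = P i" "(+>) I ` (\<Union> (P (Suc i))) = P (Suc i)"
        by (rule primeideal_Union_quot(3)[OF I P(1)], use that in simp)+
      then show "\<Union> (P i) \<noteq> \<Union> (P (Suc i))" using less_imp_neq[OF P(2)[OF that]] by metis
    qed
    then show "n \<in> ?B"
      using primeideal_Union_quot(1,2)[OF I P(1)]
      by (intro CollectI exI[of _ "\<lambda>i. \<Union> (P i)"] conjI allI impI)
  next
    fix n assume "n \<in> ?B"
    then obtain P where P: "\<And>i. i \<le> n \<Longrightarrow> primeideal (P i) R" "\<And>i. i \<le> n \<Longrightarrow> I \<subseteq> P i"
      "\<And>i. i < n \<Longrightarrow> P i \<subset> P (Suc i)" by blast
    have "((+>) I ` P i) \<subset> ((+>) I ` P (Suc i))" if "i < n" for i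
    proof
      show "(+>) I ` P i \<subseteq> (+>) I ` P (Suc i)" using P(3)[OF that] by blast
      have "\<Union> ((+>) I ` P i) = P i" "\<Union> ((+>) I ` P (Suc i)) = P (Suc i)"
        by (rule primeideal_quot(2)[OF I P(1,2)], use that in simp, use that in simp)+
      then show "(+>) I ` P i \<noteq> (+>) I ` P (Suc i)" using less_imp_neq[OF P(3)[OF that]] by metis
    qed
    then show "n \<in> ?A"
      using primeideal_quot(1)[OF I P(1,2)]
      by (intro CollectI exI[of _ "\<lambda>i. (+>) I ` P i"] conjI allI impI)
  qed
  then show ?thesis by (simp add: krull_dim_def)
qed

section \<open>Ideals of the polynomial ring as plain sets\<close>

lemma ring_of_type_algebra_simps [simp]:
  "carrier ring_of_type_algebra = UNIV" "x \<otimes>\<^bsub>ring_of_type_algebra\<^esub> y = x * y"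
  "x \<oplus>\<^bsub>ring_of_type_algebra\<^esub> y = x + y" "\<one>\<^bsub>ring_of_type_algebra\<^esub> = 1" "\<zero>\<^bsub>ring_of_type_algebra\<^esub> = 0"
  by (simp_all add: ring_of_type_algebra_def)

lemma ideal_ring_of_type_algebra_iff:
  "ideal I (ring_of_type_algebra :: 'a::comm_ring_1 ring) \<longleftrightarrow>
     0 \<in> I \<and> (\<forall>a\<in>I. \<forall>b\<in>I. a + b \<in> I) \<and> (\<forall>a\<in>I. \<forall>x. x * a \<in> I)"
proof
  assume "ideal I (ring_of_type_algebra :: 'a ring)"
  then interpret ideal I "ring_of_type_algebra :: 'a ring" .
  show "0 \<in> I \<and> (\<forall>a\<in>I. \<forall>b\<in>I. a + b \<in> I) \<and> (\<forall>a\<in>I. \<forall>x. x * a \<in> I)"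
    using additive_subgroup.zero_closed[OF additive_subgroup_axioms]
      additive_subgroup.a_closed[OF additive_subgroup_axioms] I_l_closed by auto
next
  interpret R: cring "ring_of_type_algebra :: 'a ring" by (rule cring_from_type_algebra)
  assume I: "0 \<in> I \<and> (\<forall>a\<in>I. \<forall>b\<in>I. a + b \<in> I) \<and> (\<forall>a\<in>I. \<forall>x. x * a \<in> I)"
  show "ideal I (ring_of_type_algebra :: 'a ring)"
  proof (rule idealI[OF R.ring_axioms])
    show "subgroup I (add_monoid ring_of_type_algebra)"
    proof (rule R.add.subgroupI)
      fix a assume "a \<in> I"
      then have "- 1 * a \<in> I" using I by blast
      moreover have "\<ominus>\<^bsub>ring_of_type_algebra\<^esub> a = - a"
        by (rule R.minus_equality) auto
      ultimately show "\<ominus>\<^bsub>ring_of_type_algebra\<^esub> a \<in> I" by simp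
    qed (use I in auto)
  qed (use I in \<open>auto simp: mult.commute\<close>)
qed

lemma primeideal_ring_of_type_algebra_iff:
  "primeideal P (ring_of_type_algebra :: 'a::comm_ring_1 ring) \<longleftrightarrow>
     ideal P (ring_of_type_algebra :: 'a ring) \<and> 1 \<notin> P \<and> (\<forall>a b. a * b \<in> P \<longrightarrow> a \<in> P \<or> b \<in> P)"
proof
  assume "primeideal P (ring_of_type_algebra :: 'a ring)"
  then interpret primeideal P "ring_of_type_algebra :: 'a ring" .
  show "ideal P (ring_of_type_algebra :: 'a ring) \<and> 1 \<notin> P \<and> (\<forall>a b. a * b \<in> P \<longrightarrow> a \<in> P \<or> b \<in> P)"
    using is_ideal I_notcarr I_prime one_imp_carrier by auto
next
  assume P: "ideal P (ring_of_type_algebra :: 'a ring) \<and> 1 \<notin> P \<and> (\<forall>a b. a * b \<in> P \<longrightarrow> a \<in> P \<or> b \<in> P)"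
  show "primeideal P (ring_of_type_algebra :: 'a ring)"
    using P by (intro primeidealI cring_from_type_algebra) auto
qed

lemma ideal_push_kernel:
  fixes f :: "('s::finite \<Rightarrow>\<^sub>0 nat) \<Rightarrow> ('s \<Rightarrow>\<^sub>0 nat)"
  assumes "\<And>a b. f (a + f b) = f (a + b)"
  shows "ideal (push_kernel f :: ('s, 'k::field) mpoly set) ring_of_type_algebra"
  unfolding ideal_ring_of_type_algebra_iff
proof (intro conjI ballI allI)
  fix p q :: "('s, 'k) mpoly" assume "p \<in> push_kernel f"
  then have "push f p = 0" by (simp add: push_kernel_def)
  then show "q * p \<in> push_kernel f"
    using push_mult_congruence[OF assms, of q p] by (simp add: push_kernel_def)
qed (auto simp: push_kernel_def push_add)

text \<open>Under a linear order the leading exponents of two factors add up and their term cannot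
  cancel, so \<open>push f\<close> is a homomorphism into a domain.\<close>

lemma primeideal_push_kernel:
  fixes f :: "('s::finite \<Rightarrow>\<^sub>0 nat) \<Rightarrow> 'g::{ordered_cancel_comm_monoid_add, linorder}"
  assumes "\<And>a b. f (a + b) = f a + f b"
  shows "primeideal (push_kernel f :: ('s, 'k::field) mpoly set) ring_of_type_algebra"
  unfolding primeideal_ring_of_type_algebra_iff ideal_ring_of_type_algebra_iff
proof (intro conjI ballI allI impI)
  have mult: "push f (p * q) = push f p * push f q" for p q :: "('s, 'k) mpoly"
    by (rule push_mult[OF assms])
  show "q * p \<in> push_kernel f" if "p \<in> push_kernel f" for p q :: "('s, 'k) mpoly"
    using that by (simp add: push_kernel_def mult)
  show "p \<in> push_kernel f \<or> q \<in> push_kernel f" if "p * q \<in> push_kernel f" for p q :: "('s, 'k) mpoly"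
    using that by (simp add: push_kernel_def mult)
  have "push f (1 :: ('s, 'k) mpoly) = Poly_Mapping.single (f 0) 1"
    using push_single[of f 0 "1 :: 'k"] by simp
  also have "\<dots> \<noteq> 0" by (metis lookup_single_eq lookup_zero zero_neq_one)
  finally show "(1 :: ('s, 'k) mpoly) \<notin> push_kernel f" by (simp add: push_kernel_def)
qed (auto simp: push_kernel_def push_add)

text \<open>A nonzero divisor \<open>f\<close> of degree \<open>d\<close> modulo \<open>P 0\<close> that vanishes modulo \<open>P 1\<close> yields
  $H_{P_0}(i) \ge H_{P_1}(i) + H_{P_0}(i-d)$ for the Hilbert functions of the quotients.\<close>

lemma prime_chain_growth:
  fixes P :: "nat \<Rightarrow> ('s::finite, 'k::field) mpoly set"
  assumes "\<And>i. i \<le> n \<Longrightarrow> primeideal (P i) ring_of_type_algebra"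
    and "\<And>i. i < n \<Longrightarrow> P i \<subset> P (Suc i)"
  shows "\<exists>D>0. \<forall>j. \<exists>B. finite B \<and> B \<subseteq> deg_le (D * j) \<and> indep_mod (P 0) B \<and> (j + n) choose n \<le> card B"
  using assms
proof (induction n arbitrary: P)
  case 0
  have P: "ideal (P 0) ring_of_type_algebra" "1 \<notin> P 0"
    using 0(1)[of 0] unfolding primeideal_ring_of_type_algebra_iff by auto
  \<comment> \<open>For n = 0 the binomial coefficient is 1, and the element 1 is independent modulo
    a proper ideal.\<close>
  have "indep_mod (P 0) {1}"
    unfolding indep_mod_def
  proof (intro allI impI ballI)
    fix T u and b :: "('s, 'k) mpoly"
    assume T: "finite T \<and> T \<subseteq> {1} \<and> (\<Sum>b\<in>T. scal (u b) b) \<in> P 0" "b \<in> T"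
    then have T1: "T = {1}" "b = 1" by auto
    then have "scal (u 1) 1 \<in> P 0" using T by simp
    then have "scal (inverse (u 1)) 1 * scal (u 1) 1 \<in> P 0"
      using P unfolding ideal_ring_of_type_algebra_iff by blast
    then have "u 1 \<noteq> 0 \<Longrightarrow> 1 \<in> P 0" by (simp add: scal_def mult_single)
    then show "u b = 0" using P T1 by auto
  qed
  then show ?case by (intro exI[of _ 1] conjI allI exI[of _ "{1}"]) (auto simp: deg_le_def total_deg_def)
next
  case (Suc n)
  have "\<exists>D>0. \<forall>j. \<exists>B. finite B \<and> B \<subseteq> deg_le (D * j) \<and> indep_mod (P (Suc 0)) B \<and> (j + n) choose n \<le> card B"
    using Suc.IH[of "\<lambda>i. P (Suc i)"] Suc.prems by simp
  then obtain D where D: "D > 0" "\<And>j. \<exists>B. finite B \<and> B \<subseteq> deg_le (D * j) \<and> indep_mod (P (Suc 0)) B \<and>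
      (j + n) choose n \<le> card B" by blast
  obtain f where f: "f \<in> P (Suc 0)" "f \<notin> P 0" using Suc.prems(2)[of 0] by auto
  obtain e where e: "f \<in> deg_le e" using deg_le_exists by blast
  have sub: "P 0 \<subseteq> P (Suc 0)" using Suc.prems(2)[of 0] by auto
  have I1: "ideal (P (Suc 0)) ring_of_type_algebra"
    using Suc.prems(1)[of "Suc 0"] unfolding primeideal_ring_of_type_algebra_iff by auto
  have zero: "0 \<in> P 0"
    using Suc.prems(1)[of 0]
    by (simp add: primeideal_ring_of_type_algebra_iff ideal_ring_of_type_algebra_iff)
  have I0: "\<And>a b. a * b \<in> P 0 \<Longrightarrow> a \<in> P 0 \<or> b \<in> P 0"
    using Suc.prems(1)[of 0] unfolding primeideal_ring_of_type_algebra_iff by auto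
  have mult1: "f * q \<in> P (Suc 0)" for q
    using I1 f(1) unfolding ideal_ring_of_type_algebra_iff by (metis mult.commute)
  have diff1: "a \<in> P (Suc 0)" if "a + b \<in> P (Suc 0)" "b \<in> P (Suc 0)" for a b
  proof -
    have "(a + b) + (- 1) * b \<in> P (Suc 0)"
      using that I1 unfolding ideal_ring_of_type_algebra_iff by blast
    then show ?thesis by simp
  qed
  have indep_mono: "indep_mod (P 0) B" if "indep_mod (P (Suc 0)) B" for B
    using that sub unfolding indep_mod_def by blast
  \<comment> \<open>The slope D + e has room for \<open>D * Suc j\<close>, the degree of the part
    from \<open>P (Suc 0)\<close>, and for the e added by one multiplication with \<open>f\<close>.
    Summing the inequality over j is Pascal's rule.\<close>
  have "\<exists>B. finite B \<and> B \<subseteq> deg_le ((D + e) * j) \<and> indep_mod (P 0) B \<and> (j + Suc n) choose Suc n \<le> card B" for j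
  proof (induction j)
    case 0
    obtain B where B: "finite B" "B \<subseteq> deg_le (D * 0)" "indep_mod (P (Suc 0)) B" "(0 + n) choose n \<le> card B"
      using D(2)[of 0] by blast
    then show ?case using indep_mono by (intro exI[of _ B]) auto
  next
    case (Suc j)
    obtain B where B: "finite B" "B \<subseteq> deg_le (D * Suc j)" "indep_mod (P (Suc 0)) B"
      "(Suc j + n) choose n \<le> card B"
      using D(2)[of "Suc j"] by blast
    obtain C where C: "finite C" "C \<subseteq> deg_le ((D + e) * j)" "indep_mod (P 0) C"
      "(j + Suc n) choose Suc n \<le> card C"
      using Suc.IH by blast
    have B0: "b \<notin> P (Suc 0)" if "b \<in> B" for b
    proof
      assume "b \<in> P (Suc 0)"
      then have "finite {b} \<and> {b} \<subseteq> B \<and> (\<Sum>x\<in>{b}. scal 1 x) \<in> P (Suc 0)" using that by simp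
      then have "\<forall>x\<in>{b}. (1::'k) = 0"
        using B(3)[unfolded indep_mod_def, rule_format, of "{b}" "\<lambda>_. 1"] by blast
      then show False by simp
    qed
    have inj: "inj_on ((*) f) C"
    proof (rule inj_onI, rule ccontr)
      fix a b assume ab: "a \<in> C" "b \<in> C" "f * a = f * b" "a \<noteq> b"
      then have "f * (a - b) = 0" by (simp add: algebra_simps)
      then have "f * (a - b) \<in> P 0" using zero by simp
      then have "a - b \<in> P 0" using I0 f by blast
      then have "finite {a, b} \<and> {a, b} \<subseteq> C \<and> (\<Sum>x\<in>{a, b}. scal (if x = a then 1 else - 1) x) \<in> P 0"
        using ab by simp
      then have "\<forall>x\<in>{a, b}. (if x = a then 1 else - 1 :: 'k) = 0"
        using C(3)[unfolded indep_mod_def, rule_format, of "{a, b}" "\<lambda>x. if x = a then 1 else - 1"] by blast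
      then show False by simp
    qed
    have disj: "B \<inter> ((*) f ` C) = {}" using B0 mult1 by auto
    \<comment> \<open>A relation modulo \<open>P 0\<close> is read twice: modulo
      \<open>P (Suc 0)\<close> the multiples of \<open>f\<close> vanish and the coefficients on
      \<open>B\<close> are zero; then \<open>f\<close> is cancelled modulo the prime
      \<open>P 0\<close>, which leaves a relation on \<open>C\<close>.\<close>
    have "indep_mod (P 0) (B \<union> ((*) f ` C))"
      unfolding indep_mod_def
    proof (intro allI impI)
      fix T u
      assume T: "finite T \<and> T \<subseteq> B \<union> ((*) f ` C) \<and> (\<Sum>b\<in>T. scal (u b) b) \<in> P 0"
      define T1 where "T1 = T \<inter> B"
      define T2 where "T2 = {c \<in> C. f * c \<in> T}"
      have T_eq: "T = T1 \<union> ((*) f ` T2)" using T by (auto simp: T1_def T2_def)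
      have fin: "finite T1" "finite T2" using T C by (auto simp: T1_def T2_def)
      have "T1 \<inter> ((*) f ` T2) = {}" using disj by (auto simp: T1_def T2_def)
      then have "(\<Sum>b\<in>T. scal (u b) b) = (\<Sum>b\<in>T1. scal (u b) b) + (\<Sum>b\<in>(*) f ` T2. scal (u b) b)"
        unfolding T_eq using fin by (intro sum.union_disjoint) auto
      also have "(\<Sum>b\<in>(*) f ` T2. scal (u b) b) = f * (\<Sum>c\<in>T2. scal (u (f * c)) c)"
        by (subst sum.reindex)
           (auto intro: inj_on_subset[OF inj] simp: T2_def scal_mult sum_distrib_left)
      finally have split: "(\<Sum>b\<in>T. scal (u b) b) =
        (\<Sum>b\<in>T1. scal (u b) b) + f * (\<Sum>c\<in>T2. scal (u (f * c)) c)" .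
      have "(\<Sum>b\<in>T. scal (u b) b) \<in> P (Suc 0)" using T sub by blast
      then have "(\<Sum>b\<in>T1. scal (u b) b) \<in> P (Suc 0)" unfolding split by (rule diff1[OF _ mult1])
      then have u1: "\<forall>b\<in>T1. u b = 0"
        using B(3) fin unfolding indep_mod_def T1_def by blast
      then have "(\<Sum>b\<in>T1. scal (u b) b) = 0" by simp
      then have "f * (\<Sum>c\<in>T2. scal (u (f * c)) c) \<in> P 0" using split T by simp
      then have "(\<Sum>c\<in>T2. scal (u (f * c)) c) \<in> P 0" using I0 f by blast
      then have "\<forall>c\<in>T2. u (f * c) = 0"
        using C(3)[unfolded indep_mod_def, rule_format, of T2 "\<lambda>c. u (f * c)"] fin
        by (auto simp: T2_def)
      then show "\<forall>b\<in>T. u b = 0" using u1 T_eq by auto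
    qed
    moreover have "B \<union> ((*) f ` C) \<subseteq> deg_le ((D + e) * Suc j)"
    proof -
      have "D * Suc j \<le> (D + e) * Suc j" by (rule mult_le_mono1) simp
      then have "B \<subseteq> deg_le ((D + e) * Suc j)" using B(2) deg_le_mono by blast
      moreover have "(*) f ` C \<subseteq> deg_le (e + (D + e) * j)"
        using C(2) e by (auto intro: deg_le_mult)
      moreover have "e + (D + e) * j \<le> (D + e) * Suc j" by simp
      ultimately show ?thesis using deg_le_mono by blast
    qed
    moreover have "card (B \<union> ((*) f ` C)) = card B + card C"
      using B C disj inj by (simp add: card_Un_disjoint card_image)
    moreover have "(Suc j + Suc n) choose Suc n = ((Suc j + n) choose n) + ((j + Suc n) choose Suc n)"
      by simp
    ultimately show ?case
      using B C by (intro exI[of _ "B \<union> ((*) f ` C)"]) auto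
  qed
  then show ?case using D(1) by (intro exI[of _ "D + e"]) auto
qed

section \<open>Lattice ideals and their Krull dimension\<close>

lemma additive_group_simps [simp]:
  "carrier additive_group = UNIV" "x \<otimes>\<^bsub>additive_group\<^esub> y = x + y" "\<one>\<^bsub>additive_group\<^esub> = 0"
  by (simp_all add: additive_group_def)

lemma comm_group_additive_group: "comm_group (additive_group :: 'a::ab_group_add monoid)"
  by (rule comm_groupI) (auto simp: algebra_simps intro: exI[of _ "- x" for x])

lemma inv_additive_group: "inv\<^bsub>additive_group\<^esub> x = - (x :: 'a::ab_group_add)"
  by (rule group.inv_equality[OF comm_group.axioms(2)[OF comm_group_additive_group]]) auto

lemma subgroup_additive_group_iff:
  "subgroup L additive_group \<longleftrightarrow> 0 \<in> L \<and> (\<forall>a\<in>L. \<forall>b\<in>L. a + b \<in> L) \<and> (\<forall>a\<in>L. - a \<in> L)"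
  unfolding subgroup_def by (auto simp: inv_additive_group)

lemma
  assumes "subgroup L additive_group"
  shows lattice_zero: "0 \<in> L"
    and lattice_add: "a \<in> L \<Longrightarrow> b \<in> L \<Longrightarrow> a + b \<in> L"
    and lattice_uminus: "a \<in> L \<Longrightarrow> - a \<in> L"
    and lattice_diff: "a \<in> L \<Longrightarrow> b \<in> L \<Longrightarrow> a - b \<in> L"
  using assms unfolding subgroup_additive_group_iff by (metis diff_conv_add_uminus)+

definition lattice_coset :: "'a::ab_group_add set \<Rightarrow> 'a \<Rightarrow> 'a set" where
  "lattice_coset L x = {y. y - x \<in> L}"

lemma lattice_coset_eq_iff:
  assumes "subgroup L additive_group"
  shows "lattice_coset L x = lattice_coset L y \<longleftrightarrow> x - y \<in> L"
proof
  have "x - x \<in> L" using lattice_zero[OF assms] by simp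
  moreover assume "lattice_coset L x = lattice_coset L y"
  ultimately show "x - y \<in> L" unfolding lattice_coset_def by blast
next
  assume xy: "x - y \<in> L"
  have "z - x \<in> L \<longleftrightarrow> z - y \<in> L" for z
    using lattice_add[OF assms _ xy, of "z - x"] lattice_diff[OF assms _ xy, of "z - y"] by auto
  then show "lattice_coset L x = lattice_coset L y" by (simp add: lattice_coset_def)
qed

definition exp_vec :: "('s::finite \<Rightarrow>\<^sub>0 nat) \<Rightarrow> int ^ 's" where
  "exp_vec m = (\<chi> j. int (Poly_Mapping.lookup m j))"

lemma exp_vec_add: "exp_vec (a + b) = exp_vec a + exp_vec b"
  by (simp add: exp_vec_def vec_eq_iff lookup_add)

lemma lookup_pos_part: "Poly_Mapping.lookup (pos_part a) j = nat (a $ j)"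
  by (simp add: pos_part_def)

lemma exp_vec_pos_part: "(\<And>j. 0 \<le> a $ j) \<Longrightarrow> exp_vec (pos_part a) = a"
  by (simp add: exp_vec_def vec_eq_iff lookup_pos_part)

lemma exp_vec_pos_part_diff: "exp_vec (pos_part a) - exp_vec (pos_part (- a)) = a"
  by (simp add: exp_vec_def vec_eq_iff lookup_pos_part)

text \<open>A normal form by mere choice: exponents of one coset pose the same choice problem, hence
  get the same answer. Its degree is not controlled.\<close>

definition lattice_rep :: "(int ^ 's::finite) set \<Rightarrow> ('s \<Rightarrow>\<^sub>0 nat) \<Rightarrow> ('s \<Rightarrow>\<^sub>0 nat)" where
  "lattice_rep L m = (SOME n. exp_vec n \<in> lattice_coset L (exp_vec m))"

lemma lattice_rep_diff:
  assumes "subgroup L additive_group"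
  shows "exp_vec (lattice_rep L m) - exp_vec m \<in> L"
proof -
  have "exp_vec m \<in> lattice_coset L (exp_vec m)"
    using lattice_zero[OF assms] by (simp add: lattice_coset_def)
  then have "exp_vec (lattice_rep L m) \<in> lattice_coset L (exp_vec m)"
    unfolding lattice_rep_def by (rule someI)
  then show ?thesis by (simp add: lattice_coset_def)
qed

lemma lattice_rep_eq_iff:
  assumes L: "subgroup L additive_group"
  shows "lattice_rep L m = lattice_rep L n \<longleftrightarrow> exp_vec m - exp_vec n \<in> L"
proof
  assume eq: "lattice_rep L m = lattice_rep L n"
  show "exp_vec m - exp_vec n \<in> L"
    using lattice_diff[OF L lattice_rep_diff[OF L, of n] lattice_rep_diff[OF L, of m]] by (simp add: eq)
next
  assume "exp_vec m - exp_vec n \<in> L"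
  then show "lattice_rep L m = lattice_rep L n"
    unfolding lattice_coset_eq_iff[OF L, symmetric] lattice_rep_def by simp
qed

lemma lattice_rep_add_rep:
  assumes L: "subgroup L additive_group"
  shows "lattice_rep L (a + lattice_rep L b) = lattice_rep L (a + b)"
  using lattice_rep_diff[OF L, of b] by (simp add: lattice_rep_eq_iff[OF L] exp_vec_add)

text \<open>The generators identify exactly the monomials of a common coset. This is the basis of
  cosets behind the Hilbert function, valid over every field.\<close>

lemma lattice_ideal_eq_push_kernel:
  assumes L: "subgroup L additive_group"
  shows "lattice_ideal L = (push_kernel (lattice_rep L) :: ('s::finite, 'k::field) mpoly set)"
proof -
  interpret R: cring "ring_of_type_algebra :: ('s, 'k) mpoly ring" by (rule cring_from_type_algebra)
  let ?G = "{Poly_Mapping.single (pos_part a) 1 - Poly_Mapping.single (pos_part (- a)) 1 | a. a \<in> L}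
              :: ('s, 'k) mpoly set"
  let ?I = "lattice_ideal L :: ('s, 'k) mpoly set"
  have ideal: "ideal ?I ring_of_type_algebra"
    unfolding lattice_ideal_def by (rule R.genideal_ideal) simp
  have gen: "?G \<subseteq> ?I"
    unfolding lattice_ideal_def by (rule R.genideal_self) simp
  have "?G \<subseteq> push_kernel (lattice_rep L)"
  proof
    fix p assume "p \<in> ?G"
    then obtain a where a: "a \<in> L"
      "p = Poly_Mapping.single (pos_part a) 1 - Poly_Mapping.single (pos_part (- a)) 1" by blast
    have "lattice_rep L (pos_part a) = lattice_rep L (pos_part (- a))"
      unfolding lattice_rep_eq_iff[OF L] exp_vec_pos_part_diff by (rule a(1))
    then show "p \<in> push_kernel (lattice_rep L)" by (simp add: a(2) push_kernel_def push_diff)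
  qed
  then have "?I \<subseteq> push_kernel (lattice_rep L)"
    unfolding lattice_ideal_def
    by (intro R.genideal_minimal ideal_push_kernel lattice_rep_add_rep[OF L])
  moreover have "push_kernel (lattice_rep L) \<subseteq> ?I"
  proof
    fix p :: "('s, 'k) mpoly" assume p: "p \<in> push_kernel (lattice_rep L)"
    have binomial: "Poly_Mapping.single m 1 - Poly_Mapping.single n 1 \<in> ?I" if "exp_vec m - exp_vec n \<in> L" for m n
    proof -
      define a where "a = exp_vec m - exp_vec n"
      \<comment> \<open>The truncated difference is the componentwise minimum of \<open>m\<close>
        and \<open>n\<close>, the exponent of the common factor of the two monomials.\<close>
      define c where "c = m - pos_part a"
      have aj: "a $ j = int (Poly_Mapping.lookup m j) - int (Poly_Mapping.lookup n j)" for j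
        by (simp add: a_def exp_vec_def)
      have "m = c + pos_part a" "n = c + pos_part (- a)"
        by (rule poly_mapping_eqI, simp add: c_def lookup_add lookup_minus lookup_pos_part aj)+
      then have "(Poly_Mapping.single m 1 - Poly_Mapping.single n 1 :: ('s, 'k) mpoly) =
        Poly_Mapping.single c 1 * (Poly_Mapping.single (pos_part a) 1 - Poly_Mapping.single (pos_part (- a)) 1)"
        by (simp add: right_diff_distrib mult_single)
      moreover have "Poly_Mapping.single (pos_part a) 1 - Poly_Mapping.single (pos_part (- a)) 1 \<in> ?I"
        using gen that by (auto simp: a_def)
      ultimately show ?thesis
        using ideal unfolding ideal_ring_of_type_algebra_iff by auto
    qed
    have sum_mem: "(\<Sum>x\<in>S. g x) \<in> ?I" if "\<And>x. x \<in> S \<Longrightarrow> g x \<in> ?I" for S and g :: "_ \<Rightarrow> ('s, 'k) mpoly"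
      using that ideal unfolding ideal_ring_of_type_algebra_iff
      by (induction S rule: infinite_finite_induct) auto
    \<comment> \<open>Subtracting the vanishing pushforward writes \<open>p\<close> as a combination
      of binomials, one for each of its monomials.\<close>
    have "p = push id p - push (lattice_rep L) p"
      using p by (simp add: push_kernel_def push_ident)
    also have "\<dots> = (\<Sum>m\<in>Poly_Mapping.keys p. Poly_Mapping.single 0 (Poly_Mapping.lookup p m) *
        (Poly_Mapping.single m 1 - Poly_Mapping.single (lattice_rep L m) 1))"
      by (simp add: push_def right_diff_distrib mult_single sum_subtractf)
    also have "\<dots> \<in> ?I"
    proof (rule sum_mem)
      fix m
      have "exp_vec m - exp_vec (lattice_rep L m) \<in> L"
        using lattice_uminus[OF L lattice_rep_diff[OF L, of m]] by simp
      then show "Poly_Mapping.single 0 (Poly_Mapping.lookup p m) *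
        (Poly_Mapping.single m 1 - Poly_Mapping.single (lattice_rep L m) 1) \<in> ?I"
        using binomial ideal unfolding ideal_ring_of_type_algebra_iff by blast
    qed
    finally show "p \<in> ?I" .
  qed
  ultimately show ?thesis by (rule antisym)
qed

lemma card_image_same_fibres:
  assumes "\<And>x y. x \<in> S \<Longrightarrow> y \<in> S \<Longrightarrow> f x = f y \<longleftrightarrow> g x = g y"
  shows "card (f ` S) = card (g ` S)"
proof (rule bij_betw_same_card)
  define s where "s y = (SOME x. x \<in> S \<and> f x = y)" for y
  have s: "s (f x) \<in> S" "f (s (f x)) = f x" if "x \<in> S" for x
    using someI[of "\<lambda>z. z \<in> S \<and> f z = f x" x] that unfolding s_def by auto
  have "g (s (f x)) = g x" if "x \<in> S" for x using s[OF that] assms[of "s (f x)" x] that by simp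
  then show "bij_betw (\<lambda>y. g (s y)) (f ` S) (g ` S)"
    unfolding bij_betw_def inj_on_def using assms by (auto simp: image_image)
qed

text \<open>The Hilbert function as a count of cosets; field and chosen representatives no longer
  appear in it.\<close>

definition lattice_growth :: "(int ^ 's::finite) set \<Rightarrow> nat \<Rightarrow> nat" where
  "lattice_growth L i = card ((\<lambda>m. lattice_coset L (exp_vec m)) ` {m. total_deg m \<le> i})"

lemma card_lattice_rep:
  assumes "subgroup L additive_group"
  shows "card (lattice_rep L ` {m. total_deg m \<le> i}) = lattice_growth L i"
  unfolding lattice_growth_def
  by (rule card_image_same_fibres) (simp add: lattice_rep_eq_iff[OF assms] lattice_coset_eq_iff[OF assms])

section \<open>The Krull dimension of a lattice ideal\<close>

lemma growth_exponent_le: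
  fixes N :: "nat \<Rightarrow> nat" and D :: nat
  assumes D: "D > 0" and lower: "\<And>j. (j + n) choose n \<le> N (D * j)"
    and upper: "\<And>i. i \<ge> 1 \<Longrightarrow> real (N i) \<le> C * real i ^ d"
  shows "n \<le> d"
proof (rule ccontr)
  assume "\<not> n \<le> d"
  then have nd: "d < n" by simp
  \<comment> \<open>The constants of (j/n)^n \<le> C (D j)^d on one side; a j beyond M contradicts
    j^(n-d) \<le> M.\<close>
  define M where "M = real n ^ n * C * real D ^ d"
  obtain j :: nat where j: "real j > max M 1" using reals_Archimedean2 by blast
  then have j1: "j \<ge> 1" "real j > M" by auto
  have "real j ^ n / real n ^ n \<le> (real (j + n) / real n) ^ n"
    unfolding power_divide by (intro divide_right_mono power_mono) auto
  also have "\<dots> \<le> real ((j + n) choose n)"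
    by (rule binomial_ge_n_over_k_pow_k) simp
  also have "\<dots> \<le> real (N (D * j))" using lower[of j] by simp
  also have "\<dots> \<le> C * real (D * j) ^ d" using D j1 by (intro upper) (simp add: Suc_le_eq)
  finally have "real j ^ n / real n ^ n \<le> C * real (D * j) ^ d" .
  then have "real j ^ n \<le> M * real j ^ d"
    using nd by (simp add: M_def field_simps power_mult_distrib)
  moreover have "real j ^ n = real j ^ (n - d) * real j ^ d"
    using nd by (simp add: power_add[symmetric])
  ultimately have "real j ^ (n - d) \<le> M" using j1 by simp
  moreover have "real j ^ 1 \<le> real j ^ (n - d)" using nd j1 by (intro power_increasing) auto
  ultimately have "real j \<le> M" by (metis order_trans power_one_right)
  then show False using j1(2) by linarith
qed

text \<open>The set that \<open>prime_chain_growth\<close> makes independent modulo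
  \<open>P 0\<close> is also independent modulo the smaller ideal \<open>I\<close>, so its size is
  bounded by the Hilbert function of \<open>I\<close>.\<close>

lemma krull_dim_lattice_ideal_le:
  fixes I :: "('s::finite, 'k::field) mpoly set"
  assumes L: "subgroup L additive_group" and I: "I = lattice_ideal L"
    and P: "\<And>i. i \<le> n \<Longrightarrow> primeideal (P i) ring_of_type_algebra" "\<And>i. i < n \<Longrightarrow> P i \<subset> P (Suc i)" "I \<subseteq> P 0"
    and upper: "\<And>i. i \<ge> 1 \<Longrightarrow> real (lattice_growth L i) \<le> C * real i ^ d"
  shows "n \<le> d"
proof -
  from prime_chain_growth[of n P, OF P(1,2)] obtain D where D: "D > 0"
    "\<And>j. \<exists>B. finite B \<and> B \<subseteq> deg_le (D * j) \<and> indep_mod (P 0) B \<and> (j + n) choose n \<le> card B"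
    by blast
  have "(j + n) choose n \<le> lattice_growth L (D * j)" for j
  proof -
    obtain B where B: "B \<subseteq> deg_le (D * j)" "indep_mod (P 0) B" "(j + n) choose n \<le> card B"
      using D(2) by blast
    have "indep_mod I B" using B(2) P(3) unfolding indep_mod_def by blast
    then have "indep_mod (push_kernel (lattice_rep L)) B"
      unfolding I lattice_ideal_eq_push_kernel[OF L] .
    from indep_mod_card_le[OF this B(1)] B(3) show ?thesis
      unfolding card_lattice_rep[OF L] by simp
  qed
  from growth_exponent_le[OF D(1) this upper] show ?thesis by simp
qed

text \<open>The values of the first j functionals, packed as a finitely supported family so that all
  j share one codomain, a linearly ordered group.\<close>

definition lex_key :: "(nat \<Rightarrow> int ^ 's::finite \<Rightarrow> int) \<Rightarrow> nat \<Rightarrow> ('s \<Rightarrow>\<^sub>0 nat) \<Rightarrow> (nat \<Rightarrow>\<^sub>0 int)" where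
  "lex_key \<phi> j m = (\<Sum>k<j. Poly_Mapping.single k (\<phi> k (exp_vec m)))"

lemma lookup_lex_key: "Poly_Mapping.lookup (lex_key \<phi> j m) k = (if k < j then \<phi> k (exp_vec m) else 0)"
  by (simp add: lex_key_def lookup_sum lookup_single when_def)

text \<open>The primes of the chain are the toric ideals of the saturated lattices cut out by the first
  few of the functionals \<open>\<phi> k\<close>; they are prime because the group ring of the linearly ordered
  group \<open>nat \<Rightarrow>\<^sub>0 int\<close> has no zero divisors.\<close>

lemma lattice_ideal_prime_chain:
  fixes I :: "('s::finite, 'k::field) mpoly set" and \<phi> :: "nat \<Rightarrow> int ^ 's \<Rightarrow> int"
  assumes L: "subgroup L additive_group" and I: "I = lattice_ideal L"
    and add: "\<And>k a b. \<phi> k (a + b) = \<phi> k a + \<phi> k b"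
    and vanish: "\<And>k a. k < d \<Longrightarrow> a \<in> L \<Longrightarrow> \<phi> k a = 0"
    and indep: "\<And>j. j < d \<Longrightarrow> \<exists>a. (\<forall>k<j. \<phi> k a = 0) \<and> \<phi> j a \<noteq> 0"
  shows "\<exists>P. (\<forall>i\<le>d. primeideal (P i) (ring_of_type_algebra :: ('s, 'k) mpoly ring) \<and> I \<subseteq> P i) \<and>
     (\<forall>i<d. P i \<subset> P (Suc i))"
proof -
  have diff: "\<phi> k (a - b) = \<phi> k a - \<phi> k b" for k a b
    using add[of k "a - b" b] by simp
  let ?P = "\<lambda>j. push_kernel (lex_key \<phi> j) :: ('s, 'k) mpoly set"
  have prime: "primeideal (?P j) ring_of_type_algebra" for j
    by (rule primeideal_push_kernel)
       (simp add: lex_key_def exp_vec_add add single_add sum.distrib)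
  \<comment> \<open>Functionals vanishing on \<open>L\<close> are constant on cosets, so
    \<open>push (lex_key \<phi> j)\<close> factors through the normal form.\<close>
  have rep: "lex_key \<phi> j (lattice_rep L m) = lex_key \<phi> j m" if "j \<le> d" for j m
  proof (rule poly_mapping_eqI)
    fix k show "Poly_Mapping.lookup (lex_key \<phi> j (lattice_rep L m)) k = Poly_Mapping.lookup (lex_key \<phi> j m) k"
      using vanish[OF _ lattice_rep_diff[OF L, of m], of k] that by (simp add: lookup_lex_key diff)
  qed
  have contains: "I \<subseteq> ?P j" if "j \<le> d" for j
  proof
    fix p assume "p \<in> I"
    then have "push (lattice_rep L) p = 0"
      unfolding I lattice_ideal_eq_push_kernel[OF L] by (simp add: push_kernel_def)
    then have "0 = push (lex_key \<phi> j) (push (lattice_rep L) p)" by simp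
    also have "\<dots> = push (lex_key \<phi> j) p"
      unfolding push_push by (rule push_cong) (simp add: rep[OF that])
    finally show "p \<in> ?P j" by (simp add: push_kernel_def)
  qed
  have strict: "?P (Suc j) \<subset> ?P j" if j: "j < d" for j
  proof
    show "?P (Suc j) \<subseteq> ?P j"
    proof
      fix p :: "('s, 'k) mpoly" assume "p \<in> ?P (Suc j)"
      then have zero: "push (lex_key \<phi> (Suc j)) p = 0" by (simp add: push_kernel_def)
      \<comment> \<open>\<open>?t\<close> forgets the last coordinate: fewer functionals are a
        function of more, which gives the inclusion of kernels.\<close>
      let ?t = "\<lambda>q :: nat \<Rightarrow>\<^sub>0 int. (\<Sum>k<j. Poly_Mapping.single k (Poly_Mapping.lookup q k))"
      have "?t (lex_key \<phi> (Suc j) m) = lex_key \<phi> j m" for m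
        by (simp add: lookup_lex_key) (simp add: lex_key_def)
      then have "push (lex_key \<phi> j) p = push ?t (push (lex_key \<phi> (Suc j)) p)"
        unfolding push_push by (intro push_cong) simp
      then show "p \<in> ?P j" using zero by (simp add: push_kernel_def)
    qed
    \<comment> \<open>The binomial of such a vector \<open>a\<close> separates the two kernels: only
      the functional \<open>\<phi> j\<close> tells its two monomials apart.\<close>
    obtain a where a: "\<And>k. k < j \<Longrightarrow> \<phi> k a = 0" "\<phi> j a \<noteq> 0" using indep[OF j] by blast
    let ?p = "Poly_Mapping.single (pos_part a) 1 - Poly_Mapping.single (pos_part (- a)) 1 :: ('s, 'k) mpoly"
    have val: "\<phi> k (exp_vec (pos_part a)) - \<phi> k (exp_vec (pos_part (- a))) = \<phi> k a" for k
      unfolding diff[symmetric] exp_vec_pos_part_diff ..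
    have "\<phi> k (exp_vec (pos_part a)) = \<phi> k (exp_vec (pos_part (- a)))" if "k < j" for k
      using val[of k] a(1)[OF that] by simp
    then have "lex_key \<phi> j (pos_part a) = lex_key \<phi> j (pos_part (- a))"
      by (intro poly_mapping_eqI) (simp add: lookup_lex_key)
    then have "?p \<in> ?P j" by (simp add: push_kernel_def push_diff)
    moreover have "?p \<notin> ?P (Suc j)"
    proof
      assume "?p \<in> ?P (Suc j)"
      then have "Poly_Mapping.single (lex_key \<phi> (Suc j) (pos_part a)) (1::'k) =
          Poly_Mapping.single (lex_key \<phi> (Suc j) (pos_part (- a))) 1"
        by (simp add: push_kernel_def push_diff)
      then have "lex_key \<phi> (Suc j) (pos_part a) = lex_key \<phi> (Suc j) (pos_part (- a))"
        by (rule injD[OF inj_single_one])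
      then have "Poly_Mapping.lookup (lex_key \<phi> (Suc j) (pos_part a)) j =
          Poly_Mapping.lookup (lex_key \<phi> (Suc j) (pos_part (- a))) j" by simp
      then show False using val[of j] a(2) by (simp add: lookup_lex_key)
    qed
    ultimately show "?P (Suc j) \<noteq> ?P j" by blast
  qed
  \<comment> \<open>\<open>?P\<close> decreases with j, so the ascending chain runs from
    \<open>?P d\<close> to \<open>?P 0\<close>.\<close>
  have "?P (d - i) \<subset> ?P (d - Suc i)" if "i < d" for i
    using strict[of "d - Suc i"] that by (simp add: Suc_diff_Suc)
  then show ?thesis
    using prime contains by (intro exI[of _ "\<lambda>i. ?P (d - i)"]) simp
qed

text \<open>A convergent sequence is bounded, which caps prime chains at d, and the functionals
  supply a chain of length d. With the dimension known to be finite and the sequence convergent,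
  \<open>the_enat\<close> and \<open>lim\<close> take their intended values.\<close>

lemma quotient_degree_lattice_ideal:
  fixes \<phi> :: "nat \<Rightarrow> int ^ 's::finite \<Rightarrow> int"
  assumes L: "subgroup L additive_group"
    and add: "\<And>k a b. \<phi> k (a + b) = \<phi> k a + \<phi> k b"
    and vanish: "\<And>k a. k < d \<Longrightarrow> a \<in> L \<Longrightarrow> \<phi> k a = 0"
    and indep: "\<And>j. j < d \<Longrightarrow> \<exists>a. (\<forall>k<j. \<phi> k a = 0) \<and> \<phi> j a \<noteq> 0"
    and lim: "(\<lambda>i. real (lattice_growth L i) / real i ^ d) \<longlonglongrightarrow> l"
  shows "quotient_degree (lattice_ideal L :: ('s::finite, 'k::field) mpoly set) = fact d * l"
proof -
  interpret R: cring "ring_of_type_algebra :: ('s, 'k) mpoly ring" by (rule cring_from_type_algebra)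
  let ?I = "lattice_ideal L :: ('s, 'k) mpoly set"
  let ?R = "ring_of_type_algebra :: ('s, 'k) mpoly ring"
  let ?S = "{n. \<exists>P. (\<forall>i\<le>n. primeideal (P i) ?R \<and> ?I \<subseteq> P i) \<and> (\<forall>i<n. P i \<subset> P (Suc i))}"
  have ideal: "ideal ?I ?R"
    unfolding lattice_ideal_eq_push_kernel[OF L]
    by (rule ideal_push_kernel) (rule lattice_rep_add_rep[OF L])
  have "Bseq (\<lambda>i. real (lattice_growth L i) / real i ^ d)"
    using lim convergentI convergent_imp_Bseq by blast
  then obtain C where C: "\<And>i. norm (real (lattice_growth L i) / real i ^ d) \<le> C"
    unfolding Bseq_def by blast
  have upper: "real (lattice_growth L i) \<le> C * real i ^ d" if "i \<ge> 1" for i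
    using C[of i] that by (simp add: divide_le_eq)
  have "n \<le> d" if "n \<in> ?S" for n
  proof -
    from that obtain P where P: "\<And>i. i \<le> n \<Longrightarrow> primeideal (P i) ?R \<and> ?I \<subseteq> P i"
      "\<And>i. i < n \<Longrightarrow> P i \<subset> P (Suc i)" by blast
    then have "\<And>i. i \<le> n \<Longrightarrow> primeideal (P i) ?R" "?I \<subseteq> P 0" by auto
    from krull_dim_lattice_ideal_le[of L ?I n P, OF L refl this(1) P(2) this(2) upper] show ?thesis .
  qed
  moreover have "d \<in> ?S"
    unfolding mem_Collect_eq by (rule lattice_ideal_prime_chain[OF L refl add vanish indep])
  ultimately have "(SUP n\<in>?S. enat n) = enat d"
    by (intro antisym SUP_least SUP_upper2[of d]) auto
  then have "krull_dim (?R Quot ?I) = enat d"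
    unfolding R.krull_dim_quot[OF ideal] .
  moreover have "quotient_dim (deg_le i) (?I \<inter> deg_le i) = lattice_growth L i" for i
    unfolding lattice_ideal_eq_push_kernel[OF L] quotient_dim_push_kernel card_lattice_rep[OF L] ..
  ultimately show ?thesis
    using limI[OF lim] by (simp add: quotient_degree_def)
qed

section \<open>Real and integer linear relations\<close>

text \<open>A finite set of reals lies in the \<open>\<int>\<close>-span of a finite \<open>\<int>\<close>-independent family; this is what
  descends real linear relations between integer vectors to integer ones.\<close>

lemma real_integer_coordinates:
  fixes u :: "'a \<Rightarrow> real"
  assumes S: "finite S"
  obtains T :: "real set" and \<beta> :: "real \<Rightarrow> real" and z :: "'a \<Rightarrow> real \<Rightarrow> int"
  where "finite T" "\<And>c :: real \<Rightarrow> int. (\<Sum>t\<in>T. of_int (c t) * \<beta> t) = 0 \<Longrightarrow> \<forall>t\<in>T. c t = 0"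
    "\<And>x. x \<in> S \<Longrightarrow> u x = (\<Sum>t\<in>T. of_int (z x t) * \<beta> t)"
proof -
  define indep where
    "indep T \<longleftrightarrow> (\<forall>c :: real \<Rightarrow> int. (\<Sum>t\<in>T. of_int (c t) * t) = 0 \<longrightarrow> (\<forall>t\<in>T. c t = 0))" for T
  have fin: "finite (u ` S)" using S by simp
  \<comment> \<open>By maximality of such a set of values, every value has a nonzero integer
    multiple in its integer span.\<close>
  have "\<exists>T. (T \<subseteq> u ` S \<and> indep T) \<and> (\<forall>T'. T' \<subseteq> u ` S \<and> indep T' \<longrightarrow> card T' \<le> card T)"
    by (rule ex_has_greatest_nat[where b = "Suc (card (u ` S))" and k = "{}"])
       (auto simp: indep_def less_Suc_eq_le intro!: card_mono fin)
  then obtain T where T: "T \<subseteq> u ` S" "indep T" "\<And>T'. T' \<subseteq> u ` S \<Longrightarrow> indep T' \<Longrightarrow> card T' \<le> card T"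
    by blast
  have finT: "finite T" using T(1) fin by (rule finite_subset)
  have "\<exists>n c. n \<noteq> (0::int) \<and> of_int n * u x = (\<Sum>t\<in>T. of_int (c t :: int) * t)" if x: "x \<in> S" for x
  proof (cases "u x \<in> T")
    case True
    then have "of_int 1 * u x = (\<Sum>t\<in>T. of_int (if t = u x then 1 else 0) * t)"
      using finT by (simp add: if_distrib[of of_int] if_distrib[of "\<lambda>y. y * _"] cong: if_cong)
    then show ?thesis by (intro exI[of _ 1] exI[of _ "\<lambda>t. if t = u x then 1 else 0"]) simp
  next
    case False
    have "\<not> indep (insert (u x) T)"
    proof
      assume "indep (insert (u x) T)"
      then have "card (insert (u x) T) \<le> card T" using T(1) x by (intro T(3)) auto
      then show False using False finT by simp
    qed
    then obtain c :: "real \<Rightarrow> int" where c: "(\<Sum>t\<in>insert (u x) T. of_int (c t) * t) = 0"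
      "\<exists>t\<in>insert (u x) T. c t \<noteq> 0"
      unfolding indep_def by blast
    have rel: "of_int (c (u x)) * u x + (\<Sum>t\<in>T. of_int (c t) * t) = 0"
      using c(1) False finT by simp
    have "c (u x) \<noteq> 0"
    proof
      assume "c (u x) = 0"
      moreover from this have "(\<Sum>t\<in>T. of_int (c t) * t) = 0" using rel by simp
      ultimately show False using T(2) c(2) unfolding indep_def by blast
    qed
    moreover have "of_int (c (u x)) * u x = (\<Sum>t\<in>T. of_int (- c t) * t)"
      using rel by (simp add: sum_negf)
    ultimately show ?thesis by (intro exI[of _ "c (u x)"] exI[of _ "\<lambda>t. - c t"] conjI)
  qed
  then obtain n c where nc: "\<And>x. x \<in> S \<Longrightarrow> n x \<noteq> (0::int)"
    "\<And>x. x \<in> S \<Longrightarrow> of_int (n x) * u x = (\<Sum>t\<in>T. of_int (c x t :: int) * t)"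
    by metis
  \<comment> \<open>A common denominator: over the values divided by N all coordinates become
    integers, and scaling by 1/N preserves independence.\<close>
  define N where "N = (\<Prod>x\<in>S. n x)"
  have N0: "N \<noteq> 0" using nc(1) S by (simp add: N_def)
  show ?thesis
  proof (rule that[of T "\<lambda>t. t / of_int N" "\<lambda>x t. c x t * (\<Prod>y\<in>S - {x}. n y)"])
    show "finite T" by (rule finT)
  next
    fix c :: "real \<Rightarrow> int" assume "(\<Sum>t\<in>T. of_int (c t) * (t / of_int N)) = 0"
    then have "(\<Sum>t\<in>T. of_int (c t) * t) / of_int N = 0" by (simp add: sum_divide_distrib)
    then have "(\<Sum>t\<in>T. of_int (c t) * t) = 0" using N0 by simp
    then show "\<forall>t\<in>T. c t = 0" using T(2) unfolding indep_def by blast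
  next
    fix x assume x: "x \<in> S"
    define M where "M = (\<Prod>y\<in>S - {x}. n y)"
    have N: "N = n x * M" unfolding N_def M_def by (rule prod.remove[OF S x])
    have M0: "M \<noteq> 0" using N N0 by auto
    have "(\<Sum>t\<in>T. of_int (c x t * M) * (t / of_int N)) = (\<Sum>t\<in>T. of_int (c x t) * t) * of_int M / of_int N"
      by (simp add: sum_divide_distrib sum_distrib_left mult_ac)
    also have "\<dots> = u x"
      unfolding nc(2)[OF x, symmetric] N using nc(1)[OF x] M0 by (simp add: field_simps)
    finally show "u x = (\<Sum>t\<in>T. of_int (c x t * (\<Prod>y\<in>S - {x}. n y)) * (t / of_int N))"
      by (simp only: M_def)
  qed
qed

section \<open>Integer vectors inside the real space\<close>

definition real_vec :: "int ^ 'n::finite \<Rightarrow> real ^ 'n" where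
  "real_vec x = (\<chi> i. of_int (x $ i))"

lemma real_vec_nth [simp]: "real_vec x $ i = of_int (x $ i)"
  by (simp add: real_vec_def)

lemma real_vec_simps [simp]:
  "real_vec 0 = 0" "real_vec (x + y) = real_vec x + real_vec y" "real_vec (x - y) = real_vec x - real_vec y"
  "real_vec (- x) = - real_vec x" "real_vec (c *s x) = of_int c *\<^sub>R real_vec x"
  by (simp_all add: vec_eq_iff)

lemma real_vec_sum: "real_vec (\<Sum>x\<in>S. f x) = (\<Sum>x\<in>S. real_vec (f x))"
  by (induction S rule: infinite_finite_induct) auto

lemma real_vec_inject [simp]: "real_vec x = real_vec y \<longleftrightarrow> x = y"
  by (simp add: vec_eq_iff)

lemma inj_real_vec: "inj_on real_vec S"
  by (simp add: inj_on_def)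

lemma real_matrix_mult: "real_matrix A *v real_vec x = real_vec (A *v x)"
  by (simp add: vec_eq_iff matrix_vector_mult_def real_matrix_def map_matrix_def)

text \<open>Expanding the coefficients \<open>u x\<close> over a family \<open>\<beta> t\<close>
  independent over the integers splits the real relation into one integer relation for each t. Some
  t has a nonzero coordinate at \<open>x0\<close>, and its relation is the one taken.\<close>

lemma integer_relation:
  fixes v :: "'a \<Rightarrow> int ^ 'n::finite"
  assumes S: "finite S" and rel: "(\<Sum>x\<in>S. u x *\<^sub>R real_vec (v x)) = 0" and x0: "x0 \<in> S" "u x0 \<noteq> 0"
  shows "\<exists>c. (\<Sum>x\<in>S. c x *s v x) = 0 \<and> c x0 \<noteq> 0"
proof -
  obtain T \<beta> z where T: "finite T"
    "\<And>c :: real \<Rightarrow> int. (\<Sum>t\<in>T. of_int (c t) * \<beta> t) = 0 \<Longrightarrow> \<forall>t\<in>T. c t = 0"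
    "\<And>x. x \<in> S \<Longrightarrow> u x = (\<Sum>t\<in>T. of_int (z x t) * \<beta> t)"
    by (rule real_integer_coordinates[OF S, of u]) (rule that)
  have "\<exists>t\<in>T. z x0 t \<noteq> 0"
  proof (rule ccontr)
    assume "\<not> ?thesis"
    then have "u x0 = 0" by (simp add: T(3)[OF x0(1)])
    then show False using x0(2) by simp
  qed
  then obtain t where t: "t \<in> T" "z x0 t \<noteq> 0" by blast
  have "(\<Sum>x\<in>S. z x t *s v x) $ i = 0" for i
  proof -
    have "0 = (\<Sum>x\<in>S. u x * of_int (v x $ i))"
      using arg_cong[OF rel, of "\<lambda>y. y $ i"] by simp
    also have "\<dots> = (\<Sum>x\<in>S. \<Sum>s\<in>T. of_int (z x s) * \<beta> s * of_int (v x $ i))"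
      by (intro sum.cong refl) (simp add: T(3) sum_distrib_right)
    also have "\<dots> = (\<Sum>s\<in>T. of_int (\<Sum>x\<in>S. z x s * v x $ i) * \<beta> s)"
      by (subst sum.swap) (simp add: sum_distrib_left mult_ac)
    finally have "\<forall>s\<in>T. (\<Sum>x\<in>S. z x s * v x $ i) = 0"
      by (intro T(2)) simp
    then show ?thesis using t(1) by simp
  qed
  then have "(\<Sum>x\<in>S. z x t *s v x) = 0" by (simp add: vec_eq_iff)
  then show ?thesis using t(2) by (intro exI[of _ "\<lambda>x. z x t"]) simp
qed

lemma module_int_vec: "Modules.module ((*s) :: int \<Rightarrow> int ^ 'n::finite \<Rightarrow> int ^ 'n)"
  by unfold_locales (simp_all add: vec_eq_iff algebra_simps)

text \<open>Lets the rank of a lattice be computed as a dimension over the reals.\<close>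

lemma int_independent_iff:
  fixes B :: "(int ^ 'n::finite) set"
  assumes B: "finite B"
  shows "\<not> module.dependent ((*s) :: int \<Rightarrow> int ^ 'n \<Rightarrow> int ^ 'n) B \<longleftrightarrow> independent (real_vec ` B)"
proof
  assume indep: "\<not> module.dependent ((*s) :: int \<Rightarrow> int ^ 'n \<Rightarrow> int ^ 'n) B"
  show "independent (real_vec ` B)"
    unfolding independent_explicit_finite_subsets
  proof (intro allI impI ballI, rule ccontr)
    fix S u v assume S: "S \<subseteq> real_vec ` B" "finite S" "(\<Sum>v\<in>S. u v *\<^sub>R v) = 0" "v \<in> S" "u v \<noteq> 0"
    then obtain T where T: "T \<subseteq> B" "S = real_vec ` T" "finite T" by (meson finite_subset_image)
    then obtain b where b: "b \<in> T" "v = real_vec b" using S by auto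
    have "(\<Sum>b\<in>T. u (real_vec b) *\<^sub>R real_vec b) = 0"
      using S(3) unfolding T(2) by (simp add: sum.reindex[OF inj_real_vec])
    from integer_relation[of T "\<lambda>b. u (real_vec b)" id, simplified, OF T(3) this b(1)]
    obtain c where "(\<Sum>x\<in>T. c x *s x) = 0" "c b \<noteq> 0" using S(5) b(2) by auto
    then have "module.dependent ((*s) :: int \<Rightarrow> int ^ 'n \<Rightarrow> int ^ 'n) B"
      unfolding module.dependent_explicit[OF module_int_vec] using T b(1) by blast
    then show False using indep by simp
  qed
next
  assume indep: "independent (real_vec ` B)"
  show "\<not> module.dependent ((*s) :: int \<Rightarrow> int ^ 'n \<Rightarrow> int ^ 'n) B"
  proof
    assume "module.dependent ((*s) :: int \<Rightarrow> int ^ 'n \<Rightarrow> int ^ 'n) B"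
    then obtain T u b where T: "finite T" "T \<subseteq> B" "(\<Sum>v\<in>T. u v *s v) = 0" "b \<in> T" "u b \<noteq> 0"
      unfolding module.dependent_explicit[OF module_int_vec] by blast
    have "(\<Sum>v\<in>real_vec ` T. of_int (u (inv_into UNIV real_vec v)) *\<^sub>R v) = real_vec (\<Sum>v\<in>T. u v *s v)"
      by (simp add: sum.reindex[OF inj_real_vec] real_vec_sum inv_f_f[OF inj_real_vec])
    then have "(\<Sum>v\<in>real_vec ` T. of_int (u (inv_into UNIV real_vec v)) *\<^sub>R v) = 0" using T(3) by simp
    moreover have "finite (real_vec ` T)" "real_vec ` T \<subseteq> real_vec ` B" using T by auto
    ultimately have "\<forall>v\<in>real_vec ` T. of_int (u (inv_into UNIV real_vec v)) = (0::real)"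
      using indep unfolding independent_explicit_finite_subsets
      by (elim allE[of _ "real_vec ` T"] impE allE[of _ "\<lambda>v. of_int (u (inv_into UNIV real_vec v))"]) auto
    then have "u (inv_into UNIV real_vec (real_vec b)) = 0" using T(4) by simp
    then show False using T(5) by (simp add: inv_f_f[OF inj_real_vec])
  qed
qed

text \<open>\<open>B\<close> is a basis of the real span only; it need not generate \<open>L\<close>
  over the integers.\<close>

lemma integer_basis:
  fixes L :: "(int ^ 'n::finite) set"
  obtains B where "B \<subseteq> L" "finite B" "independent (real_vec ` B)" "real_vec ` L \<subseteq> span (real_vec ` B)"
    "card B = dim (real_vec ` L)"
proof -
  obtain C where C: "C \<subseteq> real_vec ` L" "independent C" "real_vec ` L \<subseteq> span C" "card C = dim (real_vec ` L)"
    by (rule basis_exists) (rule that)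
  have "finite C" using C(2) by (rule independent_imp_finite)
  with C(1) obtain B where B: "B \<subseteq> L" "finite B" "C = real_vec ` B" by (meson finite_subset_image)
  show ?thesis
    using C B by (intro that[of B]) (auto simp: card_image[OF inj_real_vec])
qed

lemma lattice_rank_eq_dim: "lattice_rank L = dim (real_vec ` L)"
proof -
  let ?S = "{card B | B. B \<subseteq> L \<and> finite B \<and> \<not> module.dependent (*s) B}"
  have le: "n \<le> dim (real_vec ` L)" if "n \<in> ?S" for n
  proof -
    from that obtain B where B: "n = card B" "B \<subseteq> L" "finite B" "\<not> module.dependent (*s) B"
      by (elim CollectE exE conjE)
    have "independent (real_vec ` B)" by (rule iffD1[OF int_independent_iff[OF B(3)] B(4)])
    then have "card (real_vec ` B) \<le> dim (real_vec ` L)"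
      using B by (intro independent_card_le_dim) auto
    then show ?thesis using B(1) by (simp add: card_image[OF inj_real_vec])
  qed
  obtain B where B: "B \<subseteq> L" "finite B" "independent (real_vec ` B)" "card B = dim (real_vec ` L)"
    by (rule integer_basis[of L]) (rule that)
  have "dim (real_vec ` L) \<in> ?S"
    by (intro CollectI exI[of _ B] conjI B(1,2) B(4)[symmetric] iffD2[OF int_independent_iff B(3)])
  moreover have "finite ?S" using le by (intro finite_subset[of ?S "{..dim (real_vec ` L)}"]) auto
  ultimately show ?thesis
    unfolding lattice_rank_def using le by (intro Max_eqI) auto
qed

lemma lattice_int_scale:
  fixes L :: "(int ^ 'n::finite) set"
  assumes L: "subgroup L additive_group" and x: "x \<in> L"
  shows "c *s x \<in> L"
proof -
  have nat: "int n *s x \<in> L" for n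
  proof (induction n)
    case (Suc n)
    have "int (Suc n) *s x = int n *s x + x" by (simp add: vec_eq_iff algebra_simps)
    then show ?case using lattice_add[OF L Suc x] by metis
  qed (use lattice_zero[OF L] in simp)
  show ?thesis
  proof (cases "c \<ge> 0")
    case True then show ?thesis using nat[of "nat c"] by simp
  next
    case False
    then have "c *s x = - (int (nat (- c)) *s x)" by (simp add: vec_eq_iff)
    then show ?thesis using lattice_uminus[OF L nat[of "nat (- c)"]] by simp
  qed
qed

lemma lattice_sum:
  assumes "subgroup L additive_group" "\<And>x. x \<in> S \<Longrightarrow> f x \<in> L"
  shows "(\<Sum>x\<in>S. f x) \<in> L"
  using assms(2)
  by (induction S rule: infinite_finite_induct) (auto intro: lattice_zero[OF assms(1)] lattice_add[OF assms(1)])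

text \<open>The integer points of the real span. By \<open>saturation_iff\<close> they are the
  vectors whose class modulo \<open>L\<close> is torsion, so torsion becomes a question of linear
  algebra.\<close>

definition saturation :: "(int ^ 'n::finite) set \<Rightarrow> (int ^ 'n) set" where
  "saturation L = {x. real_vec x \<in> span (real_vec ` L)}"

lemma saturation_iff:
  assumes L: "subgroup L additive_group"
  shows "x \<in> saturation L \<longleftrightarrow> (\<exists>n::nat. n > 0 \<and> int n *s x \<in> L)"
proof
  assume "x \<in> saturation L"
  then have span: "real_vec x \<in> span (real_vec ` L)" by (simp add: saturation_def)
  obtain B where B: "B \<subseteq> L" "finite B" "real_vec ` L \<subseteq> span (real_vec ` B)"
    by (rule integer_basis[of L]) (rule that)
  have "real_vec x \<in> span (real_vec ` B)"
    using span B(3) span_mono[OF B(3)] by (auto simp: span_span)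
  then obtain q where q: "real_vec x = (\<Sum>v\<in>real_vec ` B. q v *\<^sub>R v)"
    using B(2) unfolding span_finite[OF finite_imageI[OF B(2)]] by blast
  \<comment> \<open>Indexing by options keeps \<open>x\<close> apart from the basis even if
    \<open>x\<close> belongs to it; \<open>None\<close> marks the coefficient that must stay
    nonzero.\<close>
  let ?v = "\<lambda>y. case y of None \<Rightarrow> x | Some b \<Rightarrow> b"
  let ?u = "\<lambda>y. case y of None \<Rightarrow> - 1 | Some b \<Rightarrow> q (real_vec b)"
  have "(\<Sum>y\<in>insert None (Some ` B). ?u y *\<^sub>R real_vec (?v y)) = 0"
    using B(2) by (simp add: sum.reindex q sum.reindex[OF inj_real_vec])
  from integer_relation[OF _ this, of None]
  obtain c where c: "(\<Sum>y\<in>insert None (Some ` B). c y *s ?v y) = 0" "c None \<noteq> 0"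
    using B(2) by auto
  have "c None *s x + (\<Sum>b\<in>B. c (Some b) *s b) = 0"
    using c(1) B(2) by (simp add: sum.reindex)
  then have "c None *s x = - (\<Sum>b\<in>B. c (Some b) *s b)" by (simp add: eq_neg_iff_add_eq_0)
  also have "\<dots> \<in> L"
    using B(1) by (intro lattice_uminus[OF L] lattice_sum[OF L] lattice_int_scale[OF L]) auto
  finally have "c None *s x \<in> L" .
  \<comment> \<open>The sign turns the nonzero multiple into a positive one.\<close>
  then have "sgn (c None) *s (c None *s x) \<in> L" by (rule lattice_int_scale[OF L])
  then have "\<bar>c None\<bar> *s x \<in> L" by (simp add: vector_smult_assoc abs_sgn mult.commute)
  then show "\<exists>n::nat. n > 0 \<and> int n *s x \<in> L"
    using c(2) by (intro exI[of _ "nat \<bar>c None\<bar>"]) simp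
next
  assume "\<exists>n::nat. n > 0 \<and> int n *s x \<in> L"
  then obtain n :: nat where n: "n > 0" "int n *s x \<in> L" by blast
  have "(1 / real n) *\<^sub>R real_vec (int n *s x) \<in> span (real_vec ` L)"
    by (intro span_scale span_base imageI n(2))
  then show "x \<in> saturation L" using n(1) by (simp add: saturation_def)
qed

lemma finite_int_box: "finite {x :: int ^ 'n::finite. \<forall>i. a $ i \<le> x $ i \<and> x $ i \<le> b $ i}"
proof (rule finite_imageD)
  have "vec_nth ` {x :: int ^ 'n. \<forall>i. a $ i \<le> x $ i \<and> x $ i \<le> b $ i} \<subseteq> (\<Pi>\<^sub>E i\<in>UNIV. {a $ i..b $ i})"
    by (auto simp: PiE_UNIV_domain)
  then show "finite (vec_nth ` {x :: int ^ 'n. \<forall>i. a $ i \<le> x $ i \<and> x $ i \<le> b $ i})"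
    by (rule finite_subset) (rule finite_PiE, simp_all)
  show "inj_on vec_nth {x :: int ^ 'n. \<forall>i. a $ i \<le> x $ i \<and> x $ i \<le> b $ i}"
    by (simp add: inj_on_def vec_nth_inject)
qed

text \<open>Subtracting the integer parts of the coordinates along a real basis taken from
  \<open>L\<close> leaves a representative with coordinates in [0,1), hence in a fixed box with
  finitely many integer points.\<close>

lemma finite_saturation_classes:
  fixes L :: "(int ^ 'n::finite) set"
  assumes L: "subgroup L additive_group"
  shows "finite (lattice_coset L ` saturation L)"
proof -
  obtain B where B: "B \<subseteq> L" "finite B" "real_vec ` L \<subseteq> span (real_vec ` B)"
    by (rule integer_basis[of L]) (rule that)
  define M where "M = (\<chi> i. \<Sum>b\<in>B. \<bar>b $ i\<bar>)"
  let ?F = "{x :: int ^ 'n. \<forall>i. (- M) $ i \<le> x $ i \<and> x $ i \<le> M $ i}"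
  have "lattice_coset L ` saturation L \<subseteq> lattice_coset L ` ?F"
  proof clarify
    fix x assume "x \<in> saturation L"
    then have "real_vec x \<in> span (real_vec ` B)"
      using span_mono[OF B(3)] by (auto simp: span_span saturation_def)
    then obtain q where q: "real_vec x = (\<Sum>v\<in>real_vec ` B. q v *\<^sub>R v)"
      using B(2) unfolding span_finite[OF finite_imageI[OF B(2)]] by blast
    define l where "l = (\<Sum>b\<in>B. \<lfloor>q (real_vec b)\<rfloor> *s b)"
    have l: "l \<in> L" unfolding l_def
      using B(1) by (intro lattice_sum[OF L] lattice_int_scale[OF L]) auto
    have "\<bar>(x - l) $ i\<bar> \<le> M $ i" for i
    proof -
      have "of_int ((x - l) $ i) = (\<Sum>b\<in>B. frac (q (real_vec b)) * of_int (b $ i))"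
      proof -
        have "real_vec (x - l) = (\<Sum>b\<in>B. frac (q (real_vec b)) *\<^sub>R real_vec b)"
          by (simp add: q l_def real_vec_sum sum.reindex[OF inj_real_vec] frac_def
              sum_subtractf[symmetric] scaleR_diff_left)
        from arg_cong[OF this, of "\<lambda>y. y $ i"] show ?thesis by simp
      qed
      also have "\<bar>\<dots>\<bar> \<le> (\<Sum>b\<in>B. \<bar>frac (q (real_vec b)) * of_int (b $ i)\<bar>)" by (rule sum_abs)
      also have "\<dots> \<le> (\<Sum>b\<in>B. of_int \<bar>b $ i\<bar>)"
      proof (rule sum_mono)
        fix b
        have "\<bar>frac (q (real_vec b))\<bar> \<le> 1" using frac_lt_1[of "q (real_vec b)"] by simp
        then have "\<bar>frac (q (real_vec b))\<bar> * \<bar>of_int (b $ i)\<bar> \<le> 1 * \<bar>of_int (b $ i) :: real\<bar>"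
          by (rule mult_right_mono) simp
        then show "\<bar>frac (q (real_vec b)) * of_int (b $ i)\<bar> \<le> of_int \<bar>b $ i\<bar>" by (simp add: abs_mult)
      qed
      finally have "real_of_int \<bar>(x - l) $ i\<bar> \<le> of_int (M $ i)" by (simp add: M_def)
      then show ?thesis by linarith
    qed
    then have "- M $ i \<le> (x - l) $ i \<and> (x - l) $ i \<le> M $ i" for i
      unfolding abs_le_iff by (metis minus_le_iff)
    then have "x - l \<in> ?F" by simp
    moreover have "lattice_coset L x = lattice_coset L (x - l)"
      using l by (simp add: lattice_coset_eq_iff[OF L])
    ultimately show "lattice_coset L x \<in> lattice_coset L ` ?F" by blast
  qed
  then show ?thesis by (rule finite_subset) (intro finite_imageI finite_int_box)
qed

section \<open>Torsion of lattice quotients\<close>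

lemma r_coset_additive_group: "L #>\<^bsub>additive_group\<^esub> a = lattice_coset L a"
proof (intro equalityI subsetI)
  fix y assume "y \<in> lattice_coset L a"
  then show "y \<in> L #>\<^bsub>additive_group\<^esub> a"
    unfolding r_coset_def lattice_coset_def by (intro UN_I[of "y - a"]) auto
qed (auto simp: r_coset_def lattice_coset_def)

lemma carrier_additive_group_Mod: "carrier (additive_group Mod L) = range (lattice_coset L)"
  by (auto simp: FactGroup_def RCOSETS_def r_coset_additive_group)

lemma normal_additive_group: "subgroup L additive_group \<Longrightarrow> L \<lhd> additive_group"
  using comm_group.subgroup_imp_normal[OF comm_group_additive_group] .

lemma int_pow_additive_group:
  fixes x :: "int ^ 'n::finite"
  shows "x [^]\<^bsub>additive_group\<^esub> (n::nat) = int n *s x"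
proof (induction n)
  case 0
  then show ?case by (simp add: nat_pow_def)
next
  case (Suc n)
  have "x [^]\<^bsub>additive_group\<^esub> Suc n = int n *s x + x"
    using Suc by (simp add: nat_pow_def)
  then show ?case by (simp add: vec_eq_iff algebra_simps)
qed

lemma pow_additive_group_Mod:
  fixes L :: "(int ^ 'n::finite) set"
  assumes L: "subgroup L additive_group"
  shows "lattice_coset L x [^]\<^bsub>additive_group Mod L\<^esub> (n::nat) = lattice_coset L (int n *s x)"
proof -
  have G: "Group.group (additive_group :: (int ^ 'n) monoid)"
    using comm_group_additive_group by (rule comm_group.axioms(2))
  have "L #>\<^bsub>additive_group\<^esub> (x [^]\<^bsub>additive_group\<^esub> n) =
      (L #>\<^bsub>additive_group\<^esub> x) [^]\<^bsub>additive_group Mod L\<^esub> n"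
    using normal.r_coset_hom_Mod[OF normal_additive_group[OF L]] G
      normal.factorgroup_is_group[OF normal_additive_group[OF L]]
    by (intro Group.hom_nat_pow) simp_all
  then show ?thesis by (simp add: r_coset_additive_group int_pow_additive_group)
qed

lemma lattice_coset_eq_self_iff:
  assumes L: "subgroup L additive_group"
  shows "lattice_coset L x = L \<longleftrightarrow> x \<in> L"
proof -
  have "lattice_coset L 0 = L" by (simp add: lattice_coset_def)
  then show ?thesis using lattice_coset_eq_iff[OF L, of x 0] by simp
qed

lemma torsion_additive_group_Mod:
  fixes L :: "(int ^ 'n::finite) set"
  assumes L: "subgroup L additive_group"
  shows "torsion (additive_group Mod L) = lattice_coset L ` saturation L"
proof -
  have one: "\<one>\<^bsub>additive_group Mod L\<^esub> = L" by (simp add: FactGroup_def)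
  have "torsion (additive_group Mod L) =
      lattice_coset L ` {x. \<exists>n::nat. n > 0 \<and> lattice_coset L x [^]\<^bsub>additive_group Mod L\<^esub> n = L}"
    unfolding torsion_def carrier_additive_group_Mod one by auto
  also have "{x. \<exists>n::nat. n > 0 \<and> lattice_coset L x [^]\<^bsub>additive_group Mod L\<^esub> n = L} = saturation L"
    by (intro Set.set_eqI)
       (simp add: pow_additive_group_Mod[OF L] lattice_coset_eq_self_iff[OF L] saturation_iff[OF L])
  finally show ?thesis .
qed

lemma subset_saturation: "L \<subseteq> saturation L"
  unfolding saturation_def by (auto intro: span_base)

lemma torsion_free_additive_group_Mod_iff:
  fixes L :: "(int ^ 'n::finite) set"
  assumes L: "subgroup L additive_group"
  shows "torsion_free (additive_group Mod L) \<longleftrightarrow> saturation L = L"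
proof -
  have one: "\<one>\<^bsub>additive_group Mod L\<^esub> = L" by (simp add: FactGroup_def)
  have "torsion_free (additive_group Mod L) \<longleftrightarrow> lattice_coset L ` saturation L = {L}"
    by (simp only: torsion_free_def torsion_additive_group_Mod[OF L] one)
  also have "\<dots> \<longleftrightarrow> saturation L \<subseteq> L"
  proof
    assume eq: "lattice_coset L ` saturation L = {L}"
    show "saturation L \<subseteq> L"
    proof
      fix x assume "x \<in> saturation L"
      then have "lattice_coset L x = L" using eq by blast
      then show "x \<in> L" by (simp add: lattice_coset_eq_self_iff[OF L])
    qed
  next
    assume "saturation L \<subseteq> L"
    then have "lattice_coset L x = L" if "x \<in> saturation L" for x
      using that by (auto simp: lattice_coset_eq_self_iff[OF L])
    moreover have "0 \<in> saturation L" using subset_saturation lattice_zero[OF L] by blast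
    ultimately show "lattice_coset L ` saturation L = {L}" by force
  qed
  also have "\<dots> \<longleftrightarrow> saturation L = L" using subset_saturation[of L] by blast
  finally show ?thesis .
qed

lemma saturation_UNIV:
  fixes L :: "(int ^ 'n::finite) set"
  assumes "lattice_rank L = CARD('n)"
  shows "saturation L = UNIV"
proof -
  have "span (real_vec ` L) = UNIV"
    using assms unfolding lattice_rank_eq_dim by (simp add: dim_eq_full[symmetric])
  then show ?thesis by (simp add: saturation_def)
qed

section \<open>Integer kernels, orthogonal complements and column lattices\<close>

lemma dim_kernel_add_rank:
  fixes A :: "real ^ 'n ^ 'm"
  shows "dim {x. A *v x = 0} + rank A = CARD('n)"
proof -
  have "{x. A *v x = 0} = {y \<in> UNIV. \<forall>x\<in>span (rows A). orthogonal x y}"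
  proof (intro Set.set_eqI iffI)
    fix y assume "y \<in> {x. A *v x = 0}"
    then show "y \<in> {y \<in> UNIV. \<forall>x\<in>span (rows A). orthogonal x y}"
      using orthogonal_nullspace_rowspace[of A y] by (auto simp: orthogonal_commute)
  next
    fix y assume "y \<in> {y \<in> UNIV. \<forall>x\<in>span (rows A). orthogonal x y}"
    then have "orthogonal (row i A) y" for i by (auto simp: rows_def intro: span_base)
    then show "y \<in> {x. A *v x = 0}"
      by (simp add: vec_eq_iff orthogonal_def matrix_vector_mult_def inner_vec_def row_def)
  qed
  then have "dim {x. A *v x = 0} + dim (span (rows A)) = dim (UNIV :: (real ^ 'n) set)"
    using dim_subspace_orthogonal_to_vectors[of "span (rows A)" UNIV] by simp
  then show ?thesis by (simp add: row_rank_def)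
qed

lemma subgroup_int_kernel: "subgroup (int_kernel A) additive_group"
  unfolding subgroup_additive_group_iff int_kernel_def
  by (auto simp: vec_eq_iff matrix_vector_mult_def sum_negf distrib_left sum.distrib)

lemma mem_int_kernel_iff: "x \<in> int_kernel A \<longleftrightarrow> real_matrix A *v real_vec x = 0"
  unfolding int_kernel_def real_matrix_mult using real_vec_inject[of "A *v x" 0] by simp

text \<open>By dimension count \<open>L\<close> spans the whole real kernel of \<open>A\<close>, so
  both sides consist of the integer points of one real subspace.\<close>

lemma
  fixes L :: "(int ^ 's::finite) set" and A :: "int ^ 's ^ 'd::finite"
  assumes rk: "lattice_rank L + rank (real_matrix A) = CARD('s)" and sub: "L \<subseteq> int_kernel A"
  shows saturation_eq_int_kernel: "saturation L = int_kernel A"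
    and lattice_rank_int_kernel: "lattice_rank (int_kernel A) = lattice_rank L"
proof -
  let ?K = "{x. real_matrix A *v x = 0}"
  have K: "subspace ?K"
    by (auto simp: subspace_def matrix_vector_right_distrib matrix_vector_mult_scaleR)
  have dimK: "dim ?K = lattice_rank L" using dim_kernel_add_rank[of "real_matrix A"] rk by simp
  have LK: "real_vec ` L \<subseteq> ?K" using sub by (auto simp: mem_int_kernel_iff[symmetric])
  then have "span (real_vec ` L) \<subseteq> ?K" by (rule span_minimal[OF _ K])
  then have "span (real_vec ` L) = ?K"
    using K dimK by (intro subspace_dim_equal) (auto simp: lattice_rank_eq_dim)
  then show sat: "saturation L = int_kernel A"
    unfolding saturation_def by (simp add: set_eq_iff mem_int_kernel_iff)
  have "real_vec ` int_kernel A \<subseteq> ?K" by (auto simp: mem_int_kernel_iff[symmetric])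
  then have "dim (real_vec ` int_kernel A) \<le> dim ?K" by (rule dim_subset)
  moreover have "dim (real_vec ` L) \<le> dim (real_vec ` int_kernel A)" by (intro dim_subset image_mono sub)
  ultimately show "lattice_rank (int_kernel A) = lattice_rank L"
    using dimK by (simp add: lattice_rank_eq_dim)
qed

text \<open>The orthogonal complement of a set of integer vectors is spanned by integer vectors:
  expand the coordinates of \<open>w\<close> over reals independent over the integers; each
  component of the expansion is an integer vector and is itself orthogonal to
  \<open>L\<close>.\<close>

lemma integer_orthogonal_complement:
  fixes L :: "(int ^ 's::finite) set"
  shows "dim (real_vec ` {z. \<forall>a\<in>L. real_vec a \<bullet> real_vec z = 0}) + lattice_rank L = CARD('s)"
proof -
  let ?Z = "{z. \<forall>a\<in>L. real_vec a \<bullet> real_vec z = 0}"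
  let ?W = "{w. \<forall>a\<in>span (real_vec ` L). orthogonal a w}"
  have W_iff: "w \<in> ?W \<longleftrightarrow> (\<forall>a\<in>L. real_vec a \<bullet> w = 0)" for w
  proof
    assume "\<forall>a\<in>L. real_vec a \<bullet> w = 0"
    then have "orthogonal w a" if "a \<in> span (real_vec ` L)" for a
      by (intro orthogonal_to_span[OF that]) (auto simp: orthogonal_def inner_commute)
    then show "w \<in> ?W" by (auto simp: orthogonal_commute)
  next
    assume w: "w \<in> ?W"
    have "orthogonal (real_vec a) w" if "a \<in> L" for a
      using w span_base[OF imageI[OF that]] by blast
    then show "\<forall>a\<in>L. real_vec a \<bullet> w = 0" by (simp add: orthogonal_def)
  qed
  have "?W \<subseteq> span (real_vec ` ?Z)"
  proof
    fix w assume w: "w \<in> ?W"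
    obtain T \<beta> z where T: "finite T"
      "\<And>c :: real \<Rightarrow> int. (\<Sum>t\<in>T. of_int (c t) * \<beta> t) = 0 \<Longrightarrow> \<forall>t\<in>T. c t = 0"
      "\<And>i. i \<in> UNIV \<Longrightarrow> w $ i = (\<Sum>t\<in>T. of_int (z i t) * \<beta> t)"
      by (rule real_integer_coordinates[OF finite, of UNIV "\<lambda>i. w $ i"]) (rule that)
    define v where "v t = (\<chi> i. z i t)" for t
    have w_eq: "w = (\<Sum>t\<in>T. \<beta> t *\<^sub>R real_vec (v t))"
      by (simp add: vec_eq_iff T(3) v_def mult.commute)
    have "v t \<in> ?Z" if t: "t \<in> T" for t
    proof clarify
      fix a assume a: "a \<in> L"
      have "0 = real_vec a \<bullet> w" using iffD1[OF W_iff w] a by simp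
      also have "\<dots> = (\<Sum>t\<in>T. \<beta> t * (real_vec a \<bullet> real_vec (v t)))"
        unfolding w_eq by (simp add: inner_sum_right)
      also have "\<dots> = (\<Sum>t\<in>T. of_int (\<Sum>i\<in>UNIV. a $ i * v t $ i) * \<beta> t)"
        by (simp add: inner_vec_def mult.commute)
      finally have "\<forall>t\<in>T. (\<Sum>i\<in>UNIV. a $ i * v t $ i) = 0" by (intro T(2)) simp
      then have "real_of_int (\<Sum>i\<in>UNIV. a $ i * v t $ i) = 0" using t by simp
      then show "real_vec a \<bullet> real_vec (v t) = 0" by (simp add: inner_vec_def)
    qed
    then show "w \<in> span (real_vec ` ?Z)"
      unfolding w_eq by (intro span_sum span_scale span_base imageI)
  qed
  moreover have "real_vec ` ?Z \<subseteq> ?W"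
    by (rule image_subsetI) (simp only: W_iff mem_Collect_eq)
  ultimately have "dim (real_vec ` ?Z) = dim ?W" by (intro antisym dim_mono dim_subset)
  moreover have "dim {y \<in> UNIV. \<forall>x\<in>span (real_vec ` L). orthogonal x y} + dim (span (real_vec ` L))
      = dim (UNIV :: (real ^ 's) set)"
    by (rule dim_subspace_orthogonal_to_vectors) auto
  ultimately show ?thesis by (simp add: lattice_rank_eq_dim)
qed

text \<open>The rows of the matrix are independent integer vectors orthogonal to
  \<open>L\<close>.\<close>

lemma lattice_matrix_exists:
  fixes L :: "(int ^ 's::finite) set"
  assumes card: "lattice_rank L + CARD('d) = CARD('s)"
  shows "\<exists>A :: int ^ 's ^ 'd::finite. rank (real_matrix A) = CARD('d) \<and> L \<subseteq> int_kernel A"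
proof -
  let ?Z = "{z. \<forall>a\<in>L. real_vec a \<bullet> real_vec z = 0}"
  obtain B where B: "B \<subseteq> ?Z" "finite B" "independent (real_vec ` B)" "card B = dim (real_vec ` ?Z)"
    by (rule integer_basis[of ?Z]) (rule that)
  have "card B = CARD('d)" using B(4) integer_orthogonal_complement[of L] card by simp
  then obtain h where h: "bij_betw h (UNIV :: 'd set) B"
    using finite_same_card_bij[OF finite B(2)] by metis
  let ?A = "(\<chi> i. h i) :: int ^ 's ^ 'd"
  have rows: "rows (real_matrix ?A) = real_vec ` B"
  proof -
    have "row i (real_matrix ?A) = real_vec (h i)" for i
      by (simp add: row_def real_matrix_def map_matrix_def vec_eq_iff)
    then show ?thesis using bij_betw_imp_surj_on[OF h] by (auto simp: rows_def)
  qed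
  have "rank (real_matrix ?A) = card (real_vec ` B)"
    unfolding row_rank_def rows by (rule dim_eq_card_independent[OF B(3)])
  also have "\<dots> = CARD('d)" using \<open>card B = CARD('d)\<close> by (simp add: card_image[OF inj_real_vec])
  finally have "rank (real_matrix ?A) = CARD('d)" .
  moreover have "L \<subseteq> int_kernel ?A"
  proof
    fix a assume a: "a \<in> L"
    have "real_vec a \<bullet> real_vec (h i) = 0" for i
      using B(1) bij_betwE[OF h] a by blast
    then show "a \<in> int_kernel ?A"
      unfolding mem_int_kernel_iff
      by (simp add: vec_eq_iff matrix_vector_mult_def real_matrix_def map_matrix_def inner_vec_def mult.commute)
  qed
  ultimately show ?thesis by blast
qed

lemma subgroup_range_matrix: "subgroup (range ((*v) (A :: int ^ 's::finite ^ 'd::finite))) additive_group"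
  unfolding subgroup_additive_group_iff
proof (intro conjI ballI)
  show "0 \<in> range ((*v) A)" by (rule image_eqI[of _ _ 0]) (auto simp: vec_eq_iff matrix_vector_mult_def)
  show "a + b \<in> range ((*v) A)" if "a \<in> range ((*v) A)" "b \<in> range ((*v) A)" for a b
    using that by (auto simp: matrix_vector_right_distrib[symmetric])
  show "- a \<in> range ((*v) A)" if a: "a \<in> range ((*v) A)" for a
  proof -
    obtain x where "a = A *v x" using a by blast
    then have "- a = A *v (- x)" by (simp add: vec_eq_iff matrix_vector_mult_def sum_negf)
    then show ?thesis by (rule image_eqI) simp
  qed
qed

lemma matrix_vector_column_sum:
  fixes A :: "int ^ 's::finite ^ 'd::finite"
  shows "A *v x = (\<Sum>j\<in>UNIV. x $ j *s column j A)"
  by (simp add: vec_eq_iff matrix_vector_mult_def column_def mult.commute)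

lemma generate_columns:
  fixes A :: "int ^ 's::finite ^ 'd::finite"
  shows "generate additive_group (columns A) = range ((*v) A)"
proof (rule antisym)
  have G: "Group.group (additive_group :: (int ^ 'd) monoid)"
    using comm_group_additive_group by (rule comm_group.axioms(2))
  have "columns A \<subseteq> range ((*v) A)"
  proof
    fix c assume "c \<in> columns A"
    then obtain j where "c = column j A" by (auto simp: columns_def)
    then have "c = A *v axis j 1"
      by (simp add: vec_eq_iff matrix_vector_mult_def column_def axis_def if_distrib cong: if_cong)
    then show "c \<in> range ((*v) A)" by blast
  qed
  then show "generate additive_group (columns A) \<subseteq> range ((*v) A)"
    by (rule group.generate_subgroup_incl[OF G _ subgroup_range_matrix])
  have sub: "subgroup (generate additive_group (columns A)) additive_group"
    by (rule group.generate_is_subgroup[OF G]) simp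
  show "range ((*v) A) \<subseteq> generate additive_group (columns A)"
  proof clarify
    fix x
    show "A *v x \<in> generate additive_group (columns A)"
      unfolding matrix_vector_column_sum
      by (intro lattice_sum[OF sub] lattice_int_scale[OF sub] generate.incl) (auto simp: columns_def)
  qed
qed

text \<open>For full row rank the column lattice has finite index, and every class modulo it is
  torsion.\<close>

lemma saturation_range_matrix:
  fixes A :: "int ^ 's::finite ^ 'd::finite"
  assumes "rank (real_matrix A) = CARD('d)"
  shows "saturation (range ((*v) A)) = UNIV"
proof (rule saturation_UNIV)
  have "columns (real_matrix A) \<subseteq> real_vec ` range ((*v) A)"
  proof
    fix c assume "c \<in> columns (real_matrix A)"
    then obtain j where "c = column j (real_matrix A)" by (auto simp: columns_def)
    then have "c = real_vec (A *v axis j 1)"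
      by (simp add: vec_eq_iff matrix_vector_mult_def column_def axis_def real_matrix_def map_matrix_def
          if_distrib cong: if_cong)
    then show "c \<in> real_vec ` range ((*v) A)" by blast
  qed
  then have "dim (columns (real_matrix A)) \<le> dim (real_vec ` range ((*v) A))" by (rule dim_subset)
  moreover have "dim (real_vec ` range ((*v) A)) \<le> CARD('d)"
    using dim_subset_UNIV[of "real_vec ` range ((*v) A)"] by simp
  ultimately show "lattice_rank (range ((*v) A)) = CARD('d)"
    using assms by (simp add: lattice_rank_eq_dim column_rank_def)
qed

text \<open>Since the column lattice has finite index, it contains a positive multiple of each unit
  vector; a preimage of it is killed by all rows but one.\<close>

lemma triangular_functionals:
  fixes A :: "int ^ 's::finite ^ 'd::finite"
  assumes rank: "rank (real_matrix A) = CARD('d)" and e: "bij_betw e {..<CARD('d)} (UNIV :: 'd set)"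
    and j: "j < CARD('d)"
  shows "\<exists>a. (\<forall>k<j. (A *v a) $ e k = 0) \<and> (A *v a) $ e j \<noteq> 0"
proof -
  have "axis (e j) 1 \<in> saturation (range ((*v) A))"
    by (simp add: saturation_range_matrix[OF rank])
  then obtain n :: nat where n: "n > 0" "int n *s axis (e j) 1 \<in> range ((*v) A)"
    unfolding saturation_iff[OF subgroup_range_matrix] by (elim exE conjE)
  then obtain a where a: "int n *s axis (e j) 1 = A *v a" by (elim imageE)
  have "e k \<noteq> e j" if "k < j" for k
    using bij_betw_imp_inj_on[OF e] that j by (auto dest: inj_onD)
  then show ?thesis
    using n(1) by (intro exI[of _ a]) (simp add: a[symmetric] axis_def)
qed

section \<open>Counting cosets by lattice points\<close>

text \<open>For t > 0 the dilate by t of the hull of 0 and the columns. The weights sum to at most t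
  because the vertex 0 absorbs the rest; explicit weights are what gets rounded later.\<close>

definition column_simplex :: "int ^ 's::finite ^ 'd::finite \<Rightarrow> real \<Rightarrow> (real ^ 'd) set" where
  "column_simplex A t =
     {\<Sum>j\<in>UNIV. l j *\<^sub>R real_vec (column j A) | l. (\<forall>j. 0 \<le> l j) \<and> (\<Sum>j\<in>UNIV. l j) \<le> t}"

lemma column_simplexI:
  assumes "\<And>j. 0 \<le> l j" "(\<Sum>j\<in>UNIV. l j) \<le> t"
  shows "(\<Sum>j\<in>UNIV. l j *\<^sub>R real_vec (column j A)) \<in> column_simplex A t"
  using assms unfolding column_simplex_def by blast

lemma column_simplexE:
  assumes "x \<in> column_simplex A t"
  obtains l where "\<And>j. 0 \<le> l j" "(\<Sum>j\<in>UNIV. l j) \<le> t" "x = (\<Sum>j\<in>UNIV. l j *\<^sub>R real_vec (column j A))"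
  using assms unfolding column_simplex_def by blast

lemma column_simplex_add:
  assumes "x \<in> column_simplex A s" "y \<in> column_simplex A t"
  shows "x + y \<in> column_simplex A (s + t)"
proof -
  obtain l where l: "\<And>j. 0 \<le> l j" "(\<Sum>j\<in>UNIV. l j) \<le> s" "x = (\<Sum>j\<in>UNIV. l j *\<^sub>R real_vec (column j A))"
    using assms(1) by (rule column_simplexE) (rule that)
  obtain k where k: "\<And>j. 0 \<le> k j" "(\<Sum>j\<in>UNIV. k j) \<le> t" "y = (\<Sum>j\<in>UNIV. k j *\<^sub>R real_vec (column j A))"
    using assms(2) by (rule column_simplexE) (rule that)
  have "x + y = (\<Sum>j\<in>UNIV. (l j + k j) *\<^sub>R real_vec (column j A))"
    by (simp add: l(3) k(3) scaleR_add_left sum.distrib)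
  also have "\<dots> \<in> column_simplex A (s + t)"
    by (rule column_simplexI) (use l k in \<open>simp_all add: sum.distrib add_mono\<close>)
  finally show ?thesis .
qed

lemma column_simplex_scale:
  assumes "t > 0"
  shows "column_simplex A t = (*\<^sub>R) t ` column_simplex A 1"
proof (intro equalityI subsetI)
  fix x assume "x \<in> column_simplex A t"
  then obtain l where l: "\<And>j. 0 \<le> l j" "(\<Sum>j\<in>UNIV. l j) \<le> t" "x = (\<Sum>j\<in>UNIV. l j *\<^sub>R real_vec (column j A))"
    by (rule column_simplexE) (rule that)
  have "(\<Sum>j\<in>UNIV. l j / t) \<le> 1" using l(2) assms by (simp add: sum_divide_distrib[symmetric])
  then have "(\<Sum>j\<in>UNIV. (l j / t) *\<^sub>R real_vec (column j A)) \<in> column_simplex A 1"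
    by (intro column_simplexI) (use l assms in auto)
  moreover have "x = t *\<^sub>R (\<Sum>j\<in>UNIV. (l j / t) *\<^sub>R real_vec (column j A))"
    using assms by (simp add: l(3) scaleR_sum_right)
  ultimately show "x \<in> (*\<^sub>R) t ` column_simplex A 1" by blast
next
  fix x assume "x \<in> (*\<^sub>R) t ` column_simplex A 1"
  then obtain y where y: "x = t *\<^sub>R y" "y \<in> column_simplex A 1" by blast
  from y(2) obtain l where l: "\<And>j. 0 \<le> l j" "(\<Sum>j\<in>UNIV. l j) \<le> 1" "y = (\<Sum>j\<in>UNIV. l j *\<^sub>R real_vec (column j A))"
    by (rule column_simplexE) (rule that)
  have "t * (\<Sum>j\<in>UNIV. l j) \<le> t" using l(2) assms by simp
  then have "(\<Sum>j\<in>UNIV. (t * l j) *\<^sub>R real_vec (column j A)) \<in> column_simplex A t"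
    by (intro column_simplexI) (use l assms in \<open>auto simp: sum_distrib_left[symmetric]\<close>)
  then show "x \<in> column_simplex A t" by (simp add: y(1) l(3) scaleR_sum_right)
qed

lemma convex_column_simplex: "convex (column_simplex A t)"
proof (rule convexI)
  fix x y and u v :: real
  assume xy: "x \<in> column_simplex A t" "y \<in> column_simplex A t" and uv: "0 \<le> u" "0 \<le> v" "u + v = 1"
  obtain l where l: "\<And>j. 0 \<le> l j" "(\<Sum>j\<in>UNIV. l j) \<le> t" "x = (\<Sum>j\<in>UNIV. l j *\<^sub>R real_vec (column j A))"
    using xy(1) by (rule column_simplexE) (rule that)
  obtain k where k: "\<And>j. 0 \<le> k j" "(\<Sum>j\<in>UNIV. k j) \<le> t" "y = (\<Sum>j\<in>UNIV. k j *\<^sub>R real_vec (column j A))"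
    using xy(2) by (rule column_simplexE) (rule that)
  have "u * (\<Sum>j\<in>UNIV. l j) + v * (\<Sum>j\<in>UNIV. k j) \<le> u * t + v * t"
    using l k uv by (intro add_mono mult_left_mono)
  also have "\<dots> = t" using uv(3) by (simp add: distrib_right[symmetric])
  finally have "(\<Sum>j\<in>UNIV. u * l j + v * k j) \<le> t" by (simp add: sum.distrib sum_distrib_left)
  then have "(\<Sum>j\<in>UNIV. (u * l j + v * k j) *\<^sub>R real_vec (column j A)) \<in> column_simplex A t"
    using l k uv by (intro column_simplexI) auto
  then show "u *\<^sub>R x + v *\<^sub>R y \<in> column_simplex A t"
    by (simp add: l(3) k(3) scaleR_add_left sum.distrib scaleR_sum_right)
qed

lemma columns_real_matrix: "columns (real_matrix A) = range (\<lambda>j. real_vec (column j A))"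
proof -
  have "column j (real_matrix A) = real_vec (column j A)" for j
    by (simp add: vec_eq_iff column_def real_matrix_def map_matrix_def)
  then show ?thesis by (auto simp: columns_def)
qed

lemma column_simplex_one: "column_simplex A 1 = convex hull (insert 0 (columns (real_matrix A)))"
proof (rule antisym)
  let ?S = "insert 0 (columns (real_matrix A))"
  show "column_simplex A 1 \<subseteq> convex hull ?S"
  proof
    fix x assume "x \<in> column_simplex A 1"
    then obtain l where l: "\<And>j. 0 \<le> l j" "(\<Sum>j\<in>UNIV. l j) \<le> 1" "x = (\<Sum>j\<in>UNIV. l j *\<^sub>R real_vec (column j A))"
      by (rule column_simplexE) (rule that)
    let ?a = "\<lambda>y. case y of None \<Rightarrow> 1 - (\<Sum>j\<in>UNIV. l j) | Some j \<Rightarrow> l j"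
    let ?y = "\<lambda>y. case y of None \<Rightarrow> 0 | Some j \<Rightarrow> real_vec (column j A)"
    have "(\<Sum>y\<in>insert None (range Some). ?a y *\<^sub>R ?y y) \<in> convex hull ?S"
    proof (rule convex_sum)
      show "?y y \<in> convex hull ?S" if "y \<in> insert None (range Some)" for y
        using that by (intro hull_inc) (auto simp: columns_real_matrix)
    qed (use l in \<open>auto simp: sum.reindex\<close>)
    then show "x \<in> convex hull ?S" by (simp add: sum.reindex l(3))
  qed
  have "real_vec (column i A) \<in> column_simplex A 1" for i
    using column_simplexI[of "\<lambda>j. if j = i then 1 else 0" 1 A]
    by (simp add: if_distrib[of "\<lambda>c. c *\<^sub>R _"] cong: if_cong)
  moreover have "0 \<in> column_simplex A 1"
    using column_simplexI[of "\<lambda>j. 0" 1 A] by simp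
  ultimately have "?S \<subseteq> column_simplex A 1" by (auto simp: columns_real_matrix)
  then show "convex hull ?S \<subseteq> column_simplex A 1"
    by (rule hull_minimal) (rule convex_column_simplex)
qed

text \<open>Only points of the column lattice are counted, since only these lie below cosets; its
  index in the integer vectors enters in the comparison with volume.\<close>

definition simplex_points :: "int ^ 's::finite ^ 'd::finite \<Rightarrow> real \<Rightarrow> (int ^ 'd) set" where
  "simplex_points A t = {w \<in> range ((*v) A). real_vec w \<in> column_simplex A t}"

lemma finite_simplex_points: "finite (simplex_points A t)"
proof (rule finite_subset)
  define b where "b = (\<chi> k. \<lceil>t * (\<Sum>j\<in>UNIV. \<bar>of_int (A $ k $ j)\<bar>)\<rceil>)"
  show "simplex_points A t \<subseteq> {w. \<forall>k. (- b) $ k \<le> w $ k \<and> w $ k \<le> b $ k}"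
  proof (intro subsetI CollectI allI)
    fix w k assume "w \<in> simplex_points A t"
    then have "real_vec w \<in> column_simplex A t" by (simp add: simplex_points_def)
    then obtain l where l: "\<And>j. 0 \<le> l j" "(\<Sum>j\<in>UNIV. l j) \<le> t"
      "real_vec w = (\<Sum>j\<in>UNIV. l j *\<^sub>R real_vec (column j A))"
      by (rule column_simplexE) (rule that)
    have "l j \<le> t" for j
      using member_le_sum[of j UNIV l] l(1,2) by fastforce
    have "of_int (w $ k) = (\<Sum>j\<in>UNIV. l j * of_int (A $ k $ j))"
      using arg_cong[OF l(3), of "\<lambda>y. y $ k"] by (simp add: column_def)
    also have "\<bar>\<dots>\<bar> \<le> (\<Sum>j\<in>UNIV. \<bar>l j * of_int (A $ k $ j)\<bar>)" by (rule sum_abs)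
    also have "\<dots> \<le> (\<Sum>j\<in>UNIV. t * \<bar>of_int (A $ k $ j)\<bar>)"
      using l(1) \<open>\<And>j. l j \<le> t\<close> by (intro sum_mono) (simp add: abs_mult mult_right_mono)
    also have "\<dots> \<le> of_int (b $ k)" by (simp add: b_def sum_distrib_left[symmetric])
    finally have "\<bar>w $ k\<bar> \<le> b $ k" by linarith
    then show "(- b) $ k \<le> w $ k \<and> w $ k \<le> b $ k"
      unfolding abs_le_iff by (metis minus_le_iff vector_uminus_component)
  qed
  show "finite {w. \<forall>k. (- b) $ k \<le> w $ k \<and> w $ k \<le> b $ k}" by (rule finite_int_box)
qed

definition fibre_classes :: "(int ^ 's::finite) set \<Rightarrow> int ^ 's ^ 'd::finite \<Rightarrow> int ^ 'd \<Rightarrow> (int ^ 's) set set" where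
  "fibre_classes L A w = lattice_coset L ` {x. A *v x = w}"

text \<open>All fibres are translates of the fibre over 0, which is \<open>int_kernel A\<close>
  modulo \<open>L\<close>. This is the factor that becomes the order of the torsion
  subgroup.\<close>

lemma fibre_classes_translate:
  "fibre_classes L A (A *v x) = (\<lambda>C. (+) x ` C) ` lattice_coset L ` int_kernel A"
proof -
  have translate: "lattice_coset L (x + k) = (+) x ` lattice_coset L k" for k
  proof (intro equalityI subsetI)
    fix y assume "y \<in> lattice_coset L (x + k)"
    then have "y - x \<in> lattice_coset L k" by (simp add: lattice_coset_def algebra_simps)
    then show "y \<in> (+) x ` lattice_coset L k" by (rule image_eqI[rotated]) simp
  qed (auto simp: lattice_coset_def)
  have "{y. A *v y = A *v x} = (+) x ` int_kernel A"
  proof (intro equalityI subsetI)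
    fix y assume "y \<in> {y. A *v y = A *v x}"
    then have "y - x \<in> int_kernel A" by (simp add: int_kernel_def matrix_vector_mult_diff_distrib)
    then show "y \<in> (+) x ` int_kernel A" by (rule image_eqI[rotated]) simp
  qed (auto simp: int_kernel_def matrix_vector_right_distrib)
  then show ?thesis by (simp add: fibre_classes_def image_image translate)
qed

lemma card_fibre_classes:
  assumes "w \<in> range ((*v) A)"
  shows "card (fibre_classes L A w) = card (lattice_coset L ` int_kernel A)"
proof -
  obtain x where x: "w = A *v x" using assms by blast
  have "inj_on (\<lambda>C. (+) x ` C) (lattice_coset L ` int_kernel A)"
    by (rule inj_onI) (simp add: inj_image_eq_iff)
  then show ?thesis unfolding x fibre_classes_translate by (rule card_image)
qed

lemma finite_fibre_classes:
  assumes "w \<in> range ((*v) A)" "finite (lattice_coset L ` int_kernel A)"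
  shows "finite (fibre_classes L A w)"
proof -
  obtain x where x: "w = A *v x" using assms(1) by blast
  show ?thesis unfolding x fibre_classes_translate by (intro finite_imageI assms(2))
qed

text \<open>Fibres over different points are disjoint because \<open>A\<close> is constant on cosets
  of \<open>L\<close>, so their sizes add up.\<close>

lemma finite_card_fibres_Union:
  assumes L: "subgroup L additive_group" and sub: "L \<subseteq> int_kernel A"
    and fin: "finite (lattice_coset L ` int_kernel A)"
    and W: "W \<subseteq> range ((*v) A)" "finite W"
  shows "finite (\<Union>w\<in>W. fibre_classes L A w)"
    and "card (\<Union>w\<in>W. fibre_classes L A w) = card W * card (lattice_coset L ` int_kernel A)"
proof -
  have fin': "finite (fibre_classes L A w)" if "w \<in> W" for w
    using finite_fibre_classes[OF subsetD[OF W(1) that] fin] .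
  then show "finite (\<Union>w\<in>W. fibre_classes L A w)" using W(2) by (rule finite_UN_I[rotated])
  have disj: "fibre_classes L A v \<inter> fibre_classes L A w = {}" if "v \<noteq> w" for v w
  proof (rule ccontr)
    assume "fibre_classes L A v \<inter> fibre_classes L A w \<noteq> {}"
    then obtain x y where xy: "A *v x = v" "A *v y = w" "lattice_coset L x = lattice_coset L y"
      unfolding fibre_classes_def by auto
    then have "x - y \<in> int_kernel A" using sub by (auto simp: lattice_coset_eq_iff[OF L])
    then show False using that xy by (simp add: int_kernel_def matrix_vector_mult_diff_distrib)
  qed
  have "card (\<Union>w\<in>W. fibre_classes L A w) = (\<Sum>w\<in>W. card (fibre_classes L A w))"
    using W(2) fin' disj by (intro card_UN_disjoint) auto
  also have "\<dots> = (\<Sum>w\<in>W. card (lattice_coset L ` int_kernel A))"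
    using W(1) by (intro sum.cong refl card_fibre_classes) auto
  finally show "card (\<Union>w\<in>W. fibre_classes L A w) = card W * card (lattice_coset L ` int_kernel A)"
    by simp
qed

text \<open>An exponent vector of total degree at most i supplies the weights that place its image
  in the dilated polytope.\<close>

lemma lattice_growth_le:
  fixes L :: "(int ^ 's::finite) set" and A :: "int ^ 's ^ 'd::finite"
  assumes L: "subgroup L additive_group" and sub: "L \<subseteq> int_kernel A"
    and fin: "finite (lattice_coset L ` int_kernel A)"
  shows "lattice_growth L i \<le> card (simplex_points A (real i)) * card (lattice_coset L ` int_kernel A)"
proof -
  let ?U = "\<Union>w\<in>simplex_points A (real i). fibre_classes L A w"
  have W: "simplex_points A (real i) \<subseteq> range ((*v) A)" by (auto simp: simplex_points_def)
  have "(\<lambda>m. lattice_coset L (exp_vec m)) ` {m. total_deg m \<le> i} \<subseteq> ?U"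
  proof clarify
    fix m :: "'s \<Rightarrow>\<^sub>0 nat" assume m: "total_deg m \<le> i"
    have "real_vec (A *v exp_vec m) = (\<Sum>j\<in>UNIV. real (Poly_Mapping.lookup m j) *\<^sub>R real_vec (column j A))"
      by (simp add: matrix_vector_column_sum real_vec_sum exp_vec_def)
    also have "\<dots> \<in> column_simplex A (real i)"
    proof (rule column_simplexI)
      have "(\<Sum>j\<in>UNIV. real (Poly_Mapping.lookup m j)) = real (total_deg m)" by (simp add: total_deg_def)
      then show "(\<Sum>j\<in>UNIV. real (Poly_Mapping.lookup m j)) \<le> real i" using m by simp
    qed simp
    finally have "A *v exp_vec m \<in> simplex_points A (real i)" by (simp add: simplex_points_def)
    then show "lattice_coset L (exp_vec m) \<in> ?U"
      by (rule UN_I) (simp add: fibre_classes_def)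
  qed
  then have "lattice_growth L i \<le> card ?U"
    unfolding lattice_growth_def
    by (rule card_mono[OF finite_card_fibres_Union(1)[OF L sub fin W finite_simplex_points]])
  then show ?thesis
    by (simp only: finite_card_fibres_Union(2)[OF L sub fin W finite_simplex_points])
qed

text \<open>Rounding down the coefficients of a point of the simplex moves it by one of finitely many
  lattice points; \<open>u\<close> makes the representatives of the classes above these nonnegative.\<close>

lemma lattice_growth_ge:
  fixes L :: "(int ^ 's::finite) set" and A :: "int ^ 's ^ 'd::finite"
  assumes L: "subgroup L additive_group" and sub: "L \<subseteq> int_kernel A"
    and fin: "finite (lattice_coset L ` int_kernel A)"
  shows "\<exists>c. \<forall>i. card (simplex_points A (real i)) * card (lattice_coset L ` int_kernel A)
            \<le> lattice_growth L (i + c)"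
proof -
  \<comment> \<open>Bounds the image under \<open>A\<close> of any vector with entries in [0,1).
    Hence \<open>F\<close> contains every possible rounding error and \<open>\<C>\<close> the
    classes above it, both finite.\<close>
  define b where "b = (\<chi> k. \<Sum>j\<in>UNIV. \<bar>A $ k $ j\<bar>)"
  define F where "F = {w. \<forall>k. (- b) $ k \<le> w $ k \<and> w $ k \<le> b $ k} \<inter> range ((*v) A)"
  have F: "F \<subseteq> range ((*v) A)" "finite F"
    unfolding F_def using finite_int_box[of "- b" b] by auto
  define \<C> where "\<C> = (\<Union>w\<in>F. fibre_classes L A w)"
  have fin\<C>: "finite \<C>"
    unfolding \<C>_def by (rule finite_card_fibres_Union(1)[OF L sub fin F])
  define r where "r C = (SOME x. lattice_coset L x = C)" for C
  have r: "lattice_coset L (r (lattice_coset L x)) = lattice_coset L x" for x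
    unfolding r_def by (rule someI[of _ x]) simp
  \<comment> \<open>Dominates all chosen representatives at once: adding \<open>u\<close> makes any
    of them nonnegative with entries at most \<open>2 * u $ j\<close>, whence the constant
    \<open>c\<close>.\<close>
  define u where "u = (\<chi> j. \<Sum>C\<in>\<C>. \<bar>r C $ j\<bar>)"
  have u: "\<bar>r C $ j\<bar> \<le> u $ j" if "C \<in> \<C>" for C j
    unfolding u_def using member_le_sum[OF that, of "\<lambda>C. \<bar>r C $ j\<bar>"] fin\<C> by simp
  define c where "c = nat (\<Sum>j\<in>UNIV. 2 * u $ j)"
  have "card (simplex_points A (real i)) * card (lattice_coset L ` int_kernel A) \<le> lattice_growth L (i + c)" for i
  proof -
    \<comment> \<open>The points are moved by \<open>A *v u\<close> to match the later addition of
      \<open>u\<close> upstairs; their number stays the same.\<close>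
    let ?W = "(\<lambda>w. w + A *v u) ` simplex_points A (real i)"
    have W: "?W \<subseteq> range ((*v) A)" "finite ?W"
      using finite_simplex_points[of A "real i"]
      by (auto simp: simplex_points_def matrix_vector_right_distrib[symmetric])
    have "(\<Union>w\<in>?W. fibre_classes L A w) \<subseteq> (\<lambda>m. lattice_coset L (exp_vec m)) ` {m. total_deg m \<le> i + c}"
    proof clarify
      fix w C assume w: "w \<in> simplex_points A (real i)" and C: "C \<in> fibre_classes L A (w + A *v u)"
      obtain x where x: "A *v x = w + A *v u" "C = lattice_coset L x"
        using C unfolding fibre_classes_def by blast
      have "real_vec w \<in> column_simplex A (real i)" using w by (simp add: simplex_points_def)
      then obtain l where l: "\<And>j. 0 \<le> l j" "(\<Sum>j\<in>UNIV. l j) \<le> real i"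
        "real_vec w = (\<Sum>j\<in>UNIV. l j *\<^sub>R real_vec (column j A))"
        by (rule column_simplexE) (rule that)
      define p where "p = (\<chi> j. \<lfloor>l j\<rfloor>)"
      define y where "y = x - u - p"
      have Ay: "A *v y = w - A *v p"
        using x(1) by (simp add: y_def matrix_vector_mult_diff_distrib)
      have "\<bar>(A *v y) $ k\<bar> \<le> b $ k" for k
      proof -
        have "real_vec (A *v y) = (\<Sum>j\<in>UNIV. frac (l j) *\<^sub>R real_vec (column j A))"
          unfolding Ay
          by (simp add: l(3) matrix_vector_column_sum real_vec_sum p_def frac_def sum_subtractf[symmetric]
              scaleR_diff_left)
        from arg_cong[OF this, of "\<lambda>y. y $ k"]
        have "of_int ((A *v y) $ k) = (\<Sum>j\<in>UNIV. frac (l j) * of_int (A $ k $ j))"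
          by (simp add: column_def)
        also have "\<bar>\<dots>\<bar> \<le> (\<Sum>j\<in>UNIV. \<bar>frac (l j) * of_int (A $ k $ j)\<bar>)" by (rule sum_abs)
        also have "\<dots> \<le> (\<Sum>j\<in>UNIV. of_int \<bar>A $ k $ j\<bar>)"
        proof (rule sum_mono)
          fix j
          have "\<bar>frac (l j)\<bar> \<le> 1" using frac_lt_1[of "l j"] by simp
          then have "\<bar>frac (l j)\<bar> * \<bar>of_int (A $ k $ j)\<bar> \<le> 1 * \<bar>of_int (A $ k $ j) :: real\<bar>"
            by (rule mult_right_mono) simp
          then show "\<bar>frac (l j) * of_int (A $ k $ j)\<bar> \<le> of_int \<bar>A $ k $ j\<bar>" by (simp add: abs_mult)
        qed
        finally have "real_of_int \<bar>(A *v y) $ k\<bar> \<le> of_int (b $ k)" by (simp add: b_def)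
        then show ?thesis by linarith
      qed
      then have "- b $ k \<le> (A *v y) $ k \<and> (A *v y) $ k \<le> b $ k" for k
        unfolding abs_le_iff by (metis minus_le_iff)
      then have "A *v y \<in> F" by (simp add: F_def)
      then have y\<C>: "lattice_coset L y \<in> \<C>"
        unfolding \<C>_def fibre_classes_def by (rule UN_I) simp
      define \<rho> where "\<rho> = r (lattice_coset L y)"
      have "\<rho> - y \<in> L" using r[of y] by (simp add: \<rho>_def lattice_coset_eq_iff[OF L])
      \<comment> \<open>\<open>q\<close> replaces the remainder \<open>y\<close> of \<open>x\<close>
        = \<open>p + y + u\<close> by its representative \<open>\<rho>\<close>: the same coset, but
        nonnegative and of bounded degree.\<close>
      define q where "q = p + \<rho> + u"
      have \<rho>u: "0 \<le> \<rho> $ j + u $ j" "\<rho> $ j + u $ j \<le> 2 * u $ j" for j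
        using u[OF y\<C>, of j] by (simp_all add: \<rho>_def abs_le_iff)
      have p0: "0 \<le> p $ j" for j using l(1)[of j] by (simp add: p_def)
      have q0: "0 \<le> q $ j" for j
        using \<rho>u(1)[of j] p0[of j] by (simp add: q_def)
      have "q - x = \<rho> - y" by (simp add: q_def y_def)
      then have "lattice_coset L (exp_vec (pos_part q)) = C"
        using \<open>\<rho> - y \<in> L\<close> unfolding x(2) exp_vec_pos_part[OF q0] by (simp add: lattice_coset_eq_iff[OF L])
      moreover have "total_deg (pos_part q) \<le> i + c"
      proof -
        have "real_of_int (\<Sum>j\<in>UNIV. p $ j) \<le> (\<Sum>j\<in>UNIV. l j)"
          by (simp add: p_def sum_mono)
        then have "(\<Sum>j\<in>UNIV. p $ j) \<le> int i" using l(2) by linarith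
        moreover have "(\<Sum>j\<in>UNIV. \<rho> $ j + u $ j) \<le> (\<Sum>j\<in>UNIV. 2 * u $ j)"
          by (rule sum_mono) (rule \<rho>u(2))
        moreover have "(\<Sum>j\<in>UNIV. q $ j) = (\<Sum>j\<in>UNIV. p $ j) + (\<Sum>j\<in>UNIV. \<rho> $ j + u $ j)"
          by (simp add: q_def sum.distrib add.assoc)
        moreover have "int (total_deg (pos_part q)) = (\<Sum>j\<in>UNIV. q $ j)"
          using q0 by (simp add: total_deg_def lookup_pos_part)
        ultimately show ?thesis unfolding c_def by linarith
      qed
      ultimately show "C \<in> (\<lambda>m. lattice_coset L (exp_vec m)) ` {m. total_deg m \<le> i + c}" by blast
    qed
    then have "card (\<Union>w\<in>?W. fibre_classes L A w) \<le> lattice_growth L (i + c)"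
      unfolding lattice_growth_def by (intro card_mono finite_imageI finite_total_deg)
    moreover have "card ?W = card (simplex_points A (real i))" by (rule card_image) (simp add: inj_on_def)
    ultimately show ?thesis
      by (simp only: finite_card_fibres_Union(2)[OF L sub fin W])
  qed
  then show ?thesis by blast
qed

section \<open>Lattice points and volume\<close>

text \<open>Half open, so that every point lies in exactly one cell, found by taking floors.\<close>

definition int_cell :: "int ^ 'd::finite \<Rightarrow> (real ^ 'd) set" where
  "int_cell z = {x. \<forall>k. of_int (z $ k) \<le> x $ k \<and> x $ k < of_int (z $ k) + 1}"

lemma mem_int_cell_iff: "x \<in> int_cell z \<longleftrightarrow> (\<chi> k. \<lfloor>x $ k\<rfloor>) = z"
  by (simp add: int_cell_def vec_eq_iff floor_eq_iff)

text \<open>Convexity with boundedness yields measurability; the open and closed unit boxes on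
  either side force the measure.\<close>

lemma
  shows lmeasurable_int_cell: "int_cell z \<in> lmeasurable"
    and measure_int_cell: "measure lebesgue (int_cell z) = 1"
proof -
  let ?a = "real_vec z" and ?b = "real_vec z + 1"
  have box: "box ?a ?b \<subseteq> int_cell z" and cbox: "int_cell z \<subseteq> cbox ?a ?b"
    by (auto simp: int_cell_def mem_box_cart less_imp_le)
  have "convex (int_cell z)"
  proof -
    have "int_cell z = (\<Inter>k. {x. of_int (z $ k) \<le> x $ k} \<inter> {x. x $ k < of_int (z $ k) + 1})"
      by (auto simp: int_cell_def)
    also have "convex \<dots>"
    proof (intro convex_INT convex_Int)
      fix k
      show "convex {x :: real ^ 'a. of_int (z $ k) \<le> x $ k}"
        using convex_halfspace_ge[of "of_int (z $ k)" "axis k 1 :: real ^ 'a"] by (simp add: inner_axis')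
      show "convex {x :: real ^ 'a. x $ k < of_int (z $ k) + 1}"
        using convex_halfspace_lt[of "axis k 1 :: real ^ 'a" "of_int (z $ k) + 1"] by (simp add: inner_axis')
    qed
    finally show ?thesis .
  qed
  moreover have "bounded (int_cell z)" using bounded_subset[OF bounded_cbox cbox] .
  ultimately show meas: "int_cell z \<in> lmeasurable" by (rule measurable_convex)
  have unit: "measure lebesgue (cbox ?a ?b) = 1"
    by (subst measure_completion) (auto simp: content_cbox_if_cart interval_eq_empty_cart)
  have "measure lebesgue (int_cell z) \<le> measure lebesgue (cbox ?a ?b)"
    using cbox meas by (intro measure_mono_fmeasurable) (auto simp: fmeasurableD)
  moreover have "measure lebesgue (box ?a ?b) \<le> measure lebesgue (int_cell z)"
    using box meas by (intro measure_mono_fmeasurable) auto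
  moreover have "measure lebesgue (box ?a ?b) = measure lebesgue (cbox ?a ?b)"
    by (simp add: measure_lborel_box_eq measure_lborel_cbox_eq)
  ultimately show "measure lebesgue (int_cell z) = 1" using unit by simp
qed

lemma
  assumes Z: "finite Z"
  shows lmeasurable_int_cells: "(\<Union>z\<in>Z. int_cell z) \<in> lmeasurable"
    and measure_int_cells: "measure lebesgue (\<Union>z\<in>Z. int_cell z) = real (card Z)"
proof -
  show "(\<Union>z\<in>Z. int_cell z) \<in> lmeasurable"
    using Z by (rule fmeasurable.finite_UN) (rule lmeasurable_int_cell)
  have "measure lebesgue (\<Union>z\<in>Z. int_cell z) = (\<Sum>z\<in>Z. measure lebesgue (int_cell z))"
  proof (rule measure_UNION')
    show "pairwise (\<lambda>y z. disjnt (int_cell y) (int_cell z)) Z"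
      by (auto simp: pairwise_def disjnt_def mem_int_cell_iff)
  qed (use Z lmeasurable_int_cell in auto)
  then show "measure lebesgue (\<Union>z\<in>Z. int_cell z) = real (card Z)"
    by (simp add: measure_int_cell)
qed

lemma lmeasurable_column_simplex: "t > 0 \<Longrightarrow> column_simplex A t \<in> lmeasurable"
  and measure_column_simplex:
    "t > 0 \<Longrightarrow> measure lebesgue (column_simplex A t) = t ^ CARD('d) * measure lebesgue (column_simplex A 1)"
  for A :: "int ^ 's::finite ^ 'd::finite"
proof -
  assume t: "t > 0"
  have "bounded (column_simplex A 1)"
    unfolding column_simplex_one columns_real_matrix by (simp add: bounded_convex_hull finite_imp_bounded)
  then have "bounded (column_simplex A t)"
    unfolding column_simplex_scale[OF t] by (rule bounded_scaling)
  then show "column_simplex A t \<in> lmeasurable" by (rule measurable_convex[OF convex_column_simplex])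
  show "measure lebesgue (column_simplex A t) = t ^ CARD('d) * measure lebesgue (column_simplex A 1)"
    unfolding column_simplex_scale[OF t]
    using measure_lebesgue_affine[of t 0 "column_simplex A 1"] t by simp
qed

text \<open>Full rank gives the polytope an interior point, and dilation enlarges a ball around it
  to any radius.\<close>

lemma column_simplex_contains_ball:
  fixes A :: "int ^ 's::finite ^ 'd::finite"
  assumes rank: "rank (real_matrix A) = CARD('d)"
  shows "\<exists>c>0. \<exists>p. ball p \<rho> \<subseteq> column_simplex A c"
proof -
  let ?S = "insert 0 (columns (real_matrix A))"
  have "span (columns (real_matrix A)) = UNIV"
    using rank by (simp add: column_rank_def dim_eq_full[symmetric])
  moreover have "affine hull ?S = span ?S"
    by (rule affine_hull_span_0) (simp add: hull_inc)
  ultimately have "affine hull (column_simplex A 1) = UNIV"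
    by (simp add: column_simplex_one affine_hull_convex_hull span_insert_0)
  moreover have "rel_interior (column_simplex A 1) \<noteq> {}"
    using rel_interior_eq_empty[OF convex_column_simplex, of A 1] by (simp add: column_simplex_one)
  ultimately have "interior (column_simplex A 1) \<noteq> {}"
    by (simp add: rel_interior_interior)
  then obtain x where "x \<in> interior (column_simplex A 1)" by blast
  then obtain \<epsilon> where \<epsilon>: "\<epsilon> > 0" "ball x \<epsilon> \<subseteq> column_simplex A 1"
    unfolding mem_interior by (elim exE conjE)
  \<comment> \<open>The maximum keeps the factor positive whatever the value of \<rho>.\<close>
  define c where "c = max \<rho> 1 / \<epsilon>"
  have c: "c > 0" "\<rho> \<le> c * \<epsilon>" using \<epsilon>(1) by (auto simp: c_def)
  have "ball (c *\<^sub>R x) \<rho> \<subseteq> ball (c *\<^sub>R x) (c * \<epsilon>)" using c(2) by (rule subset_ball)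
  also have "\<dots> \<subseteq> column_simplex A c"
  proof
    fix y assume y: "y \<in> ball (c *\<^sub>R x) (c * \<epsilon>)"
    have "dist x ((1 / c) *\<^sub>R y) = (1 / c) * dist (c *\<^sub>R x) y"
    proof -
      have "x - (1 / c) *\<^sub>R y = (1 / c) *\<^sub>R (c *\<^sub>R x - y)" using c(1) by (simp add: scaleR_diff_right)
      then show ?thesis using c(1) by (simp add: dist_norm)
    qed
    also have "\<dots> < (1 / c) * (c * \<epsilon>)" using y c(1) by (intro mult_strict_left_mono) auto
    finally have "(1 / c) *\<^sub>R y \<in> column_simplex A 1" using \<epsilon>(2) c(1) by auto
    then have "c *\<^sub>R ((1 / c) *\<^sub>R y) \<in> column_simplex A c"
      unfolding column_simplex_scale[OF c(1)] by (rule imageI)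
    then show "y \<in> column_simplex A c" using c(1) by simp
  qed
  finally show ?thesis using c(1) by blast
qed

text \<open>The union of the cells at a system of representatives of \<open>\<int>\<^sup>d\<close> modulo the column lattice
  is a bounded fundamental domain of that lattice, so translates of it tile space.\<close>

lemma simplex_points_bounds:
  fixes A :: "int ^ 's::finite ^ 'd::finite"
  assumes rank: "rank (real_matrix A) = CARD('d)"
  defines "e \<equiv> card (range (lattice_coset (range ((*v) A))))"
    and "V \<equiv> measure lebesgue (column_simplex A 1)"
  shows "e > 0"
    and "\<exists>c>0. \<forall>t>0. real (e * card (simplex_points A t)) \<le> (t + c) ^ CARD('d) * V \<and>
           t ^ CARD('d) * V \<le> real (e * card (simplex_points A (t + c)))"
proof -
  let ?M = "range ((*v) A)"
  have M: "subgroup ?M additive_group" by (rule subgroup_range_matrix)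
  have fin: "finite (range (lattice_coset ?M))"
    using finite_saturation_classes[OF M] unfolding saturation_range_matrix[OF rank] .
  then show "e > 0" unfolding e_def by (simp add: card_gt_0_iff)
  define r where "r C = (SOME x. lattice_coset ?M x = C)" for C
  have r: "lattice_coset ?M (r C) = C" if "C \<in> range (lattice_coset ?M)" for C
    using someI_ex[of "\<lambda>x. lattice_coset ?M x = C"] that unfolding r_def by blast
  define R where "R = r ` range (lattice_coset ?M)"
  have finR: "finite R" unfolding R_def by (rule finite_imageI[OF fin])
  have cardR: "card R = e"
    unfolding R_def e_def by (rule card_image) (metis inj_onI r)
  have R_inj: "g = h" if "g \<in> R" "h \<in> R" "g - h \<in> ?M" for g h
  proof -
    from that(1,2) obtain C D where CD: "C \<in> range (lattice_coset ?M)" "D \<in> range (lattice_coset ?M)"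
      "g = r C" "h = r D" unfolding R_def by blast
    have "lattice_coset ?M g = lattice_coset ?M h" using that(3) by (simp add: lattice_coset_eq_iff[OF M])
    then show ?thesis using CD r by metis
  qed
  have R_rep: "\<exists>g\<in>R. z - g \<in> ?M" for z
  proof -
    have "lattice_coset ?M z = lattice_coset ?M (r (lattice_coset ?M z))" by (rule r[symmetric]) blast
    then have "z - r (lattice_coset ?M z) \<in> ?M" by (simp add: lattice_coset_eq_iff[OF M])
    then show ?thesis by (intro bexI[of _ "r (lattice_coset ?M z)"]) (auto simp: R_def)
  qed
  \<comment> \<open>Corners of the unit cells in the translates of the fundamental domain to the
    simplex points. The sums are distinct, as \<open>g\<close> is determined by its class modulo the
    column lattice.\<close>
  define cells where "cells t = (\<lambda>(m, g). m + g) ` (simplex_points A t \<times> R)" for t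
  have fin_cells: "finite (cells t)" for t
    unfolding cells_def by (intro finite_imageI finite_cartesian_product finite_simplex_points finR)
  have card_cells: "card (cells t) = e * card (simplex_points A t)" for t
  proof -
    have "inj_on (\<lambda>(m, g). m + g) (simplex_points A t \<times> R)"
    proof (rule inj_onI, clarify)
      fix m g n h assume *: "m \<in> simplex_points A t" "g \<in> R" "n \<in> simplex_points A t" "h \<in> R" "m + g = n + h"
      have "g - h = n - m" using *(5) by (simp add: algebra_simps)
      also have "\<dots> \<in> ?M"
        by (rule lattice_diff[OF M]) (use * in \<open>simp_all add: simplex_points_def\<close>)
      finally have "g = h" by (rule R_inj[OF *(2,4)])
      then show "m = n \<and> g = h" using *(5) by simp
    qed
    then show ?thesis
      unfolding cells_def by (simp add: card_image card_cartesian_product cardR mult.commute)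
  qed
  have "bounded (\<Union>g\<in>R. int_cell g)"
  proof (rule bounded_UN[OF finR], rule ballI)
    fix g
    have "int_cell g \<subseteq> cbox (real_vec g) (real_vec g + 1)"
      by (auto simp: int_cell_def mem_box_cart less_imp_le)
    then show "bounded (int_cell g)" by (rule bounded_subset[OF bounded_cbox])
  qed
  then obtain \<rho> where \<rho>: "\<And>\<delta>. \<delta> \<in> (\<Union>g\<in>R. int_cell g) \<Longrightarrow> norm \<delta> < \<rho>"
    unfolding bounded_pos_less by blast
  \<comment> \<open>For each \<delta> in the fundamental domain, both \<open>p + \<delta>\<close>
    and \<open>p - \<delta>\<close> lie in \<open>column_simplex A c\<close>; one inclusion uses the
    first, the other the second.\<close>
  obtain c p where c: "c > 0" and p: "ball p \<rho> \<subseteq> column_simplex A c"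
    using column_simplex_contains_ball[OF rank, of \<rho>] by (elim exE conjE)
  have upper: "real (e * card (simplex_points A t)) \<le> (t + c) ^ CARD('d) * V" if t: "t > 0" for t
  proof -
    let ?U = "\<Union>z\<in>cells t. int_cell z"
    \<comment> \<open>A point of a cell is \<open>m + \<delta>\<close> with \<open>m\<close> a
      simplex point; the shift by \<open>p\<close>, harmless for the measure, puts the error into
      the polytope of size c, and the sizes add.\<close>
    have "(+) p ` ?U \<subseteq> column_simplex A (t + c)"
    proof clarify
      fix x z assume z: "z \<in> cells t" and x: "x \<in> int_cell z"
      obtain m g where mg: "m \<in> simplex_points A t" "g \<in> R" "z = m + g"
        using z unfolding cells_def by auto
      have "x - real_vec m \<in> int_cell g"
        using x unfolding mg(3) int_cell_def by (simp add: algebra_simps)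
      then have "norm (x - real_vec m) < \<rho>" using mg(2) by (intro \<rho>) blast
      then have "p + (x - real_vec m) \<in> ball p \<rho>" by (simp add: dist_norm norm_minus_commute)
      then have "p + (x - real_vec m) \<in> column_simplex A c" using p by (rule subsetD[rotated])
      moreover have "real_vec m \<in> column_simplex A t" using mg(1) by (simp add: simplex_points_def)
      ultimately have "real_vec m + (p + (x - real_vec m)) \<in> column_simplex A (t + c)"
        by (rule column_simplex_add[rotated])
      then show "p + x \<in> column_simplex A (t + c)" by (simp add: algebra_simps)
    qed
    then have "measure lebesgue ((+) p ` ?U) \<le> measure lebesgue (column_simplex A (t + c))"
      using t c by (intro measure_mono_fmeasurable lmeasurable_column_simplex fmeasurableD
          measurable_translation lmeasurable_int_cells[OF fin_cells]) auto
    then show ?thesis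
      using t c by (simp add: measure_translation measure_int_cells[OF fin_cells] card_cells V_def
          measure_column_simplex[of "t + c"])
  qed
  have lower: "t ^ CARD('d) * V \<le> real (e * card (simplex_points A (t + c)))" if t: "t > 0" for t
  proof -
    let ?U = "\<Union>z\<in>cells (t + c). int_cell z"
    \<comment> \<open>Conversely, the lattice point whose translate of the fundamental domain
      contains \<open>p + x\<close> equals \<open>x + (p - \<delta>)\<close>, a sum of points from
      sizes t and c.\<close>
    have "(+) p ` column_simplex A t \<subseteq> ?U"
    proof clarify
      fix x assume x: "x \<in> column_simplex A t"
      define z where "z = (\<chi> k. \<lfloor>(p + x) $ k\<rfloor>)"
      have xz: "p + x \<in> int_cell z" by (simp add: mem_int_cell_iff z_def)
      obtain g where g: "g \<in> R" "z - g \<in> ?M" using R_rep by blast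
      define \<delta> where "\<delta> = p + x - real_vec (z - g)"
      have "\<delta> \<in> int_cell g"
        using xz unfolding \<delta>_def int_cell_def by (simp add: algebra_simps)
      then have "norm \<delta> < \<rho>" using g(1) by (intro \<rho>) blast
      then have "p - \<delta> \<in> ball p \<rho>" by (simp add: dist_norm)
      then have "p - \<delta> \<in> column_simplex A c" using p by (rule subsetD[rotated])
      with x have "x + (p - \<delta>) \<in> column_simplex A (t + c)" by (rule column_simplex_add)
      moreover have "x + (p - \<delta>) = real_vec (z - g)" by (simp add: \<delta>_def)
      ultimately have "z - g \<in> simplex_points A (t + c)" using g(2) by (simp add: simplex_points_def)
      then have "z \<in> cells (t + c)" unfolding cells_def using g(1) by (intro image_eqI[of _ _ "(z - g, g)"]) auto
      then show "p + x \<in> ?U" using xz by blast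
    qed
    then have "measure lebesgue ((+) p ` column_simplex A t) \<le> measure lebesgue ?U"
      using t by (intro measure_mono_fmeasurable lmeasurable_column_simplex fmeasurableD
          measurable_translation lmeasurable_int_cells[OF fin_cells]) auto
    then show ?thesis
      using t by (simp add: measure_translation measure_int_cells[OF fin_cells] card_cells V_def
          measure_column_simplex[OF t])
  qed
  show "\<exists>c>0. \<forall>t>0. real (e * card (simplex_points A t)) \<le> (t + c) ^ CARD('d) * V \<and>
           t ^ CARD('d) * V \<le> real (e * card (simplex_points A (t + c)))"
    using c upper lower by blast
qed

lemma shifted_power_quotient: "(\<lambda>i. (real i + c) ^ d / real i ^ d) \<longlonglongrightarrow> 1"
proof -
  have "(\<lambda>i. (1 + c / real i) ^ d) \<longlonglongrightarrow> (1 + 0) ^ d"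
    by (intro tendsto_intros lim_const_over_n)
  moreover have "\<forall>\<^sub>F i in sequentially. (1 + c / real i) ^ d = (real i + c) ^ d / real i ^ d"
    using eventually_gt_at_top[of 0]
    by eventually_elim (simp add: power_divide[symmetric] add_divide_distrib)
  ultimately show ?thesis by (simp add: tendsto_cong)
qed

text \<open>Both bounds on the growth are the same multiple of a power of i shifted by a constant: c
  from comparing points with volume, b from nonnegative representatives.\<close>

lemma lattice_growth_limit:
  fixes L :: "(int ^ 's::finite) set" and A :: "int ^ 's ^ 'd::finite"
  assumes L: "subgroup L additive_group" and sub: "L \<subseteq> int_kernel A"
    and rank: "rank (real_matrix A) = CARD('d)" and sat: "saturation L = int_kernel A"
  shows "(\<lambda>i. real (lattice_growth L i) / real i ^ CARD('d)) \<longlonglongrightarrow>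
    real (card (lattice_coset L ` int_kernel A)) *
      measure lebesgue (convex hull (insert 0 (columns (real_matrix A)))) /
      real (card (range (lattice_coset (range ((*v) A)))))"
proof -
  let ?d = "CARD('d)"
  define \<tau> where "\<tau> = card (lattice_coset L ` int_kernel A)"
  define e where "e = card (range (lattice_coset (range ((*v) A))))"
  define V where "V = measure lebesgue (column_simplex A 1)"
  have fin: "finite (lattice_coset L ` int_kernel A)"
    using finite_saturation_classes[OF L] unfolding sat .
  have e0: "e > 0" unfolding e_def by (rule simplex_points_bounds(1)[OF rank])
  obtain c where c: "c > 0"
    "\<And>t. t > 0 \<Longrightarrow> real (e * card (simplex_points A t)) \<le> (t + c) ^ ?d * V"
    "\<And>t. t > 0 \<Longrightarrow> t ^ ?d * V \<le> real (e * card (simplex_points A (t + c)))"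
    using simplex_points_bounds(2)[OF rank] unfolding e_def[symmetric] V_def[symmetric]
    by (elim exE conjE) blast
  obtain b where b: "\<And>i. card (simplex_points A (real i)) * \<tau> \<le> lattice_growth L (i + b)"
    using lattice_growth_ge[OF L sub fin] unfolding \<tau>_def by blast
  have upper: "real (lattice_growth L i) / real i ^ ?d \<le> \<tau> * V / e * ((real i + c) ^ ?d / real i ^ ?d)"
    if i: "i > 0" for i
  proof -
    have "real (lattice_growth L i) \<le> real (card (simplex_points A (real i)) * \<tau>)"
      unfolding \<tau>_def by (rule of_nat_mono) (rule lattice_growth_le[OF L sub fin])
    also have "\<dots> = \<tau> * real (e * card (simplex_points A (real i))) / e" using e0 by simp
    also have "\<dots> \<le> \<tau> * ((real i + c) ^ ?d * V) / e"
      using c(2)[of "real i"] i by (intro divide_right_mono mult_left_mono) auto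
    finally show ?thesis using i e0 by (simp add: field_simps)
  qed
  \<comment> \<open>Here the shifts accumulate: \<open>lattice_growth_ge\<close> is used at i - b,
    the volume bound c below that. Writing \<open>+ -\<close> matches
    \<open>shifted_power_quotient\<close>.\<close>
  have lower: "\<tau> * V / e * ((real i + - (c + real b)) ^ ?d / real i ^ ?d) \<le> real (lattice_growth L i) / real i ^ ?d"
    if i: "real i > c + real b" for i
  proof -
    have ib: "i \<ge> b" using i c(1) by linarith
    have t: "real i - (c + real b) > 0" using i by simp
    have "\<tau> * ((real i - (c + real b)) ^ ?d * V) / e
        \<le> \<tau> * real (e * card (simplex_points A (real i - (c + real b) + c))) / e"
      using c(3)[OF t] by (intro divide_right_mono mult_left_mono) auto
    also have "real i - (c + real b) + c = real (i - b)" using ib by simp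
    also have "\<tau> * real (e * card (simplex_points A (real (i - b)))) / e
        = real (card (simplex_points A (real (i - b))) * \<tau>)" using e0 by simp
    also have "\<dots> \<le> real (lattice_growth L i)"
      using b[of "i - b"] unfolding le_add_diff_inverse2[OF ib] by (rule of_nat_mono)
    finally show ?thesis using i c(1) e0 by (simp add: field_simps)
  qed
  have "(\<lambda>i. real (lattice_growth L i) / real i ^ ?d) \<longlonglongrightarrow> \<tau> * V / e * 1"
  proof (rule tendsto_sandwich)
    show "(\<lambda>i. \<tau> * V / e * ((real i + - (c + real b)) ^ ?d / real i ^ ?d)) \<longlonglongrightarrow> \<tau> * V / e * 1"
      by (intro tendsto_mult tendsto_const shifted_power_quotient)
    show "(\<lambda>i. \<tau> * V / e * ((real i + c) ^ ?d / real i ^ ?d)) \<longlonglongrightarrow> \<tau> * V / e * 1"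
      by (intro tendsto_mult tendsto_const shifted_power_quotient)
    show "\<forall>\<^sub>F i in sequentially. \<tau> * V / e * ((real i + - (c + real b)) ^ ?d / real i ^ ?d)
        \<le> real (lattice_growth L i) / real i ^ ?d"
    proof (rule eventually_mono)
      show "\<forall>\<^sub>F i in sequentially. c + real b < real i"
        using filterlim_real_sequentially by (rule filterlim_at_top_dense[THEN iffD1, rule_format])
    qed (rule lower)
    show "\<forall>\<^sub>F i in sequentially. real (lattice_growth L i) / real i ^ ?d
        \<le> \<tau> * V / e * ((real i + c) ^ ?d / real i ^ ?d)"
      using eventually_gt_at_top[of 0] by (rule eventually_mono) (rule upper)
  qed
  then show ?thesis unfolding \<tau>_def V_def e_def column_simplex_one by simp
qed

text \<open>The case of dimension 0, apart from the others since a matrix has at least one row, its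
  index type being nonempty. With finitely many cosets, each meeting the nonnegative vectors, one
  degree bound eventually reaches them all.\<close>

lemma lattice_growth_eventually_index:
  fixes L :: "(int ^ 's::finite) set"
  assumes L: "subgroup L additive_group" and sat: "saturation L = UNIV"
  shows "(\<lambda>i. real (lattice_growth L i)) \<longlonglongrightarrow> real (card (range (lattice_coset L)))"
proof -
  have fin: "finite (range (lattice_coset L))"
    using finite_saturation_classes[OF L] unfolding sat .
  have nonneg: "\<exists>m. lattice_coset L (exp_vec m) = lattice_coset L x" for x
  proof -
    \<comment> \<open>A positive multiple of each unit vector lies in \<open>L\<close>;
      \<open>\<bar>x $ j\<bar>\<close> copies of it lift coordinate j of \<open>x\<close> to at
      least 0.\<close>
    define y where "y j = (SOME n::nat. n > 0 \<and> int n *s axis j 1 \<in> L)" for j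
    have y: "y j > 0 \<and> int (y j) *s axis j 1 \<in> L" for j
      unfolding y_def
      by (rule someI_ex) (use saturation_iff[OF L, of "axis j 1"] in \<open>simp add: sat\<close>)
    define l where "l = (\<Sum>j\<in>UNIV. \<bar>x $ j\<bar> *s (int (y j) *s axis j 1))"
    have l: "l \<in> L" unfolding l_def
      by (rule lattice_sum[OF L]) (rule lattice_int_scale[OF L conjunct2[OF y]])
    have "l $ j = \<bar>x $ j\<bar> * int (y j)" for j
      by (simp add: l_def axis_def if_distrib cong: if_cong)
    moreover have "\<bar>x $ j\<bar> * 1 \<le> \<bar>x $ j\<bar> * int (y j)" for j
      using y[of j] by (intro mult_left_mono) auto
    ultimately have "0 \<le> (x + l) $ j" for j
      by (smt (verit) mult.right_neutral vector_add_component)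
    then have "lattice_coset L (exp_vec (pos_part (x + l))) = lattice_coset L x"
      using l by (simp add: exp_vec_pos_part lattice_coset_eq_iff[OF L])
    then show ?thesis by blast
  qed
  then obtain m where m: "\<And>x. lattice_coset L (exp_vec (m x)) = lattice_coset L x" by metis
  obtain S where S: "finite S" "range (lattice_coset L) = lattice_coset L ` S"
    using finite_subset_image[OF fin subset_refl] by blast
  define b where "b = Max (insert 0 ((\<lambda>x. total_deg (m x)) ` S))"
  have "lattice_growth L i = card (range (lattice_coset L))" if "i \<ge> b" for i
  proof -
    have "lattice_coset L ` S \<subseteq> (\<lambda>m. lattice_coset L (exp_vec m)) ` {m. total_deg m \<le> i}"
    proof clarify
      fix x assume x: "x \<in> S"
      have "total_deg (m x) \<le> b" unfolding b_def using S(1) x by (intro Max_ge) auto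
      then show "lattice_coset L x \<in> (\<lambda>m. lattice_coset L (exp_vec m)) ` {m. total_deg m \<le> i}"
        using m[of x] that by (intro image_eqI[of _ _ "m x"]) auto
    qed
    then have "(\<lambda>m. lattice_coset L (exp_vec m)) ` {m. total_deg m \<le> i} = range (lattice_coset L)"
      unfolding S(2)[symmetric] by blast
    then show ?thesis by (simp add: lattice_growth_def)
  qed
  then have "\<forall>\<^sub>F i in sequentially. real (lattice_growth L i) = real (card (range (lattice_coset L)))"
    by (auto simp: eventually_sequentially)
  then show ?thesis by (rule tendsto_eventually)
qed

theorem theorem4p6:
  fixes L :: "(int ^ 's::finite) set" and r :: nat
  assumes lattice: "subgroup L additive_group"
    and rank: "lattice_rank L = r"
  shows
    "(r = CARD('s) \<longrightarrow>
        quotient_degree (lattice_ideal L :: ('s, 'k::field) mpoly set)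
          = real (Coset.order (additive_group Mod L))) \<and>
     (r < CARD('s) \<and> CARD('d::finite) = CARD('s) - r \<longrightarrow>
        (\<exists>A :: int ^ 's ^ 'd.
           rank (real_matrix A) = CARD('s) - r \<and>
           subgroup (int_kernel A) additive_group \<and> lattice_rank (int_kernel A) = r \<and>
           L \<subseteq> int_kernel A \<and>
           (L = int_kernel A \<longleftrightarrow> torsion_free (additive_group Mod L)))) \<and>
     (r < CARD('s) \<and> CARD('d) = CARD('s) - r \<longrightarrow>
        (\<forall>A :: int ^ 's ^ 'd.
           rank (real_matrix A) = CARD('s) - r \<and> L \<subseteq> int_kernel A \<longrightarrow>
           quotient_degree (lattice_ideal L :: ('s, 'k) mpoly set)
             = real (card (torsion (additive_group Mod L))) * fact (CARD('s) - r)
                 * measure lebesgue (convex hull (insert 0 (columns (real_matrix A))))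
               / real (card (torsion (additive_group Mod generate additive_group (columns A))))))"
proof (intro conjI impI allI)
  assume "r = CARD('s)"
  then have sat: "saturation L = UNIV" using rank by (intro saturation_UNIV) simp
  \<comment> \<open>The general degree formula is applied with d = 0, where the conditions on the
    functionals are vacuous beyond additivity.\<close>
  have "(\<lambda>i. real (lattice_growth L i) / real i ^ 0) \<longlonglongrightarrow> real (card (range (lattice_coset L)))"
    using lattice_growth_eventually_index[OF lattice sat] by simp
  from quotient_degree_lattice_ideal[where \<phi> = "\<lambda>k a. 0", OF lattice _ _ _ this]
  show "quotient_degree (lattice_ideal L :: ('s, 'k) mpoly set) = real (Coset.order (additive_group Mod L))"
    by (simp add: Coset.order_def carrier_additive_group_Mod)
next
  assume r: "r < CARD('s) \<and> CARD('d) = CARD('s) - r"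
  then have "lattice_rank L + CARD('d) = CARD('s)" using rank by simp
  then obtain A :: "int ^ 's ^ 'd" where A: "rank (real_matrix A) = CARD('d)" "L \<subseteq> int_kernel A"
    using lattice_matrix_exists[where L = L and ?'d = 'd] by blast
  have sum: "lattice_rank L + rank (real_matrix A) = CARD('s)" using A(1) rank r by simp
  have "L = int_kernel A \<longleftrightarrow> torsion_free (additive_group Mod L)"
    unfolding torsion_free_additive_group_Mod_iff[OF lattice] saturation_eq_int_kernel[OF sum A(2)] by blast
  then show "\<exists>A :: int ^ 's ^ 'd.
           rank (real_matrix A) = CARD('s) - r \<and>
           subgroup (int_kernel A) additive_group \<and> lattice_rank (int_kernel A) = r \<and>
           L \<subseteq> int_kernel A \<and>
           (L = int_kernel A \<longleftrightarrow> torsion_free (additive_group Mod L))"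
    using A r rank lattice_rank_int_kernel[OF sum A(2)] subgroup_int_kernel[of A]
    by (intro exI[of _ A]) simp
next
  fix A :: "int ^ 's ^ 'd"
  assume r: "r < CARD('s) \<and> CARD('d) = CARD('s) - r"
    and A: "rank (real_matrix A) = CARD('s) - r \<and> L \<subseteq> int_kernel A"
  have rk: "rank (real_matrix A) = CARD('d)" and sub: "L \<subseteq> int_kernel A" using r A by simp_all
  have sum: "lattice_rank L + rank (real_matrix A) = CARD('s)" using A rank r by simp
  note sat = saturation_eq_int_kernel[OF sum sub]
  \<comment> \<open>An enumeration of the rows, which gives the functionals an order and thereby a
    chain.\<close>
  obtain e :: "nat \<Rightarrow> 'd" where e: "bij_betw e {..<CARD('d)} UNIV"
    using ex_bij_betw_nat_finite[of "UNIV :: 'd set"] by (auto simp: atLeast0LessThan)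
  let ?l = "real (card (lattice_coset L ` int_kernel A)) *
      measure lebesgue (convex hull (insert 0 (columns (real_matrix A)))) /
      real (card (range (lattice_coset (range ((*v) A)))))"
  have "quotient_degree (lattice_ideal L :: ('s, 'k) mpoly set) = fact CARD('d) * ?l"
  proof (rule quotient_degree_lattice_ideal[where \<phi> = "\<lambda>k a. (A *v a) $ e k", OF lattice])
    show "(A *v (a + b)) $ e k = (A *v a) $ e k + (A *v b) $ e k" for k a b
      by (simp add: matrix_vector_right_distrib)
    show "(A *v a) $ e k = 0" if "a \<in> L" for k a
      using subsetD[OF sub that] by (simp add: int_kernel_def)
    show "\<exists>a. (\<forall>k<j. (A *v a) $ e k = 0) \<and> (A *v a) $ e j \<noteq> 0" if "j < CARD('d)" for j
      by (rule triangular_functionals[OF rk e that])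
    show "(\<lambda>i. real (lattice_growth L i) / real i ^ CARD('d)) \<longlonglongrightarrow> ?l"
      by (rule lattice_growth_limit[OF lattice sub rk sat])
  qed
  \<comment> \<open>The saturation of \<open>L\<close> is \<open>int_kernel A\<close> and that of
    the column lattice is everything, so both coset counts in \<open>?l\<close> are orders of
    torsion subgroups.\<close>
  then show "quotient_degree (lattice_ideal L :: ('s, 'k) mpoly set)
             = real (card (torsion (additive_group Mod L))) * fact (CARD('s) - r)
                 * measure lebesgue (convex hull (insert 0 (columns (real_matrix A))))
               / real (card (torsion (additive_group Mod generate additive_group (columns A))))"
    using r by (simp add: torsion_additive_group_Mod[OF lattice] sat generate_columns
        torsion_additive_group_Mod[OF subgroup_range_matrix] saturation_range_matrix[OF rk] mult_ac)
qed

end
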